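(* For every constant $d>0$ and every constant $A>0$ there exist constants $c_0$ and $K$ such that the following holds. Let $n,k\ge1$, let $c\ge c_0$ be an integer, let $R\ge1$ satisfy $\log k\le AR$, and let $\widehat{x}$ be the Count-Sketch estimate of $x\in\mathbb{R}^n$ using $R$ rows and $C=ck$ columns with fully random hash functions. Then for every nonempty $S\subset[n]$ with $|S|\le k$, \[ \Pr\left[\|\widehat{x}_S-x_S\|_2^2 > |S|\cdot\frac{1}{R}\cdot\frac{\|x_{\overline{[k]}}\|_2^2}{k}\right]\le \frac{K}{|S|^{d}}. \]
   Context: Count-Sketch with $R$ rows and $C$ columns: for each row $u\in[R]$ choose hash functions $h_u:[n]\to[C]$ and $s_u:[n]\to\{\pm1\}$; "fully random" means all values $h_u(i)$ (uniform on $[C]$) and $s_u(i)$ (uniform on $\{\pm1\}$) are mutually independent. The sketch is $y_{u,v}=\sum_{i:h_u(i)=v}s_u(i)x_i$ and the estimate is $\widehat{x}_i=\operatorname{median}_{u\in[R]} s_u(i)\,y_{u,h_u(i)}$ (average of the two middle values for even $R$). $z_S$ is the restriction of $z$ to the coordinates in $S$; $x_{\overline{[k]}}$ denotes $x$ with its $k$ largest-magnitude coordinates replaced by $0$. *)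

theory Defs
  imports "HOL-Probability.Probability"
begin

text \<open>Coordinates are indexed by 0..<n, rows by 0..<R, buckets by 0..<C.
  A hash choice is a pair (h, s) with h u i the bucket of coordinate i in row u
  and s u i its sign.\<close>

definition hash_space :: "nat \<Rightarrow> nat \<Rightarrow> nat \<Rightarrow> (nat \<Rightarrow> nat \<Rightarrow> nat) set" where
  "hash_space R n C = ({0..<R} \<rightarrow>\<^sub>E ({0..<n} \<rightarrow>\<^sub>E {0..<C}))"

definition sign_space :: "nat \<Rightarrow> nat \<Rightarrow> (nat \<Rightarrow> nat \<Rightarrow> real) set" where
  "sign_space R n = ({0..<R} \<rightarrow>\<^sub>E ({0..<n} \<rightarrow>\<^sub>E {-1, 1}))"

text \<open>Fully random hash functions: uniform distribution on all (h, s),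
  i.e. all values h u i, s u i mutually independent and uniform.\<close>
definition fully_random :: "nat \<Rightarrow> nat \<Rightarrow> nat \<Rightarrow>
    ((nat \<Rightarrow> nat \<Rightarrow> nat) \<times> (nat \<Rightarrow> nat \<Rightarrow> real)) pmf" where
  "fully_random R n C = pmf_of_set (hash_space R n C \<times> sign_space R n)"

definition sketch :: "nat \<Rightarrow> (nat \<Rightarrow> nat \<Rightarrow> nat) \<Rightarrow> (nat \<Rightarrow> nat \<Rightarrow> real)
    \<Rightarrow> (nat \<Rightarrow> real) \<Rightarrow> nat \<Rightarrow> nat \<Rightarrow> real" where
  "sketch n h s x u v = (\<Sum>i\<in>{i\<in>{0..<n}. h u i = v}. s u i * x i)"

definition median :: "real list \<Rightarrow> real" where
  "median xs = (let ys = sort xs; m = length ys in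
     if odd m then ys ! (m div 2) else (ys ! (m div 2 - 1) + ys ! (m div 2)) / 2)"

definition cs_estimate :: "nat \<Rightarrow> nat \<Rightarrow> (nat \<Rightarrow> nat \<Rightarrow> nat) \<Rightarrow> (nat \<Rightarrow> nat \<Rightarrow> real)
    \<Rightarrow> (nat \<Rightarrow> real) \<Rightarrow> nat \<Rightarrow> real" where
  "cs_estimate R n h s x i = median (map (\<lambda>u. s u i * sketch n h s x u (h u i)) [0..<R])"

definition tail_sq :: "nat \<Rightarrow> nat \<Rightarrow> (nat \<Rightarrow> real) \<Rightarrow> real" where
  "tail_sq n k x = sum_list (drop k (rev (sort (map (\<lambda>i. (x i)\<^sup>2) [0..<n]))))"

end

theory Submission
  imports Defs "HOL-Real_Asymp.Real_Asymp"
begin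

text \<open>
  Fix \<open>m\<close> coordinates of \<open>S\<close>, with \<open>m\<close> of order \<open>ln |S|\<close>. Within a row, unless two of them share a bucket,
  the signs of these coordinates are independent of the noise in their buckets, so each error is
  symmetric. Revealing the buckets one after the other, each noise conditionally lies in
  \<open>[-\<epsilon>, \<epsilon>]\<close> with probability at least of order \<open>r\<close>, where \<open>r\<close> is \<open>\<epsilon>\<close> divided by the standard
  deviation \<open>\<sigma>\<close>, capped at 1. This holds because a random sign times a Bernoulli variable is a difference of two
  independent copies, and two independent copies of a variable with standard deviation \<open>\<sigma>\<close>
  are \<open>\<epsilon>\<close>-close with that probability by pigeonhole. A Chernoff bound over the rows shows that all \<open>m\<close>
  medians exceed \<open>\<epsilon>\<close> with probability at most \<open>(2 exp(-\<Omega>(R r\<^sup>2)))^m\<close>. A collision among the \<open>m\<close> coordinates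
  costs only to second order in the Chernoff parameter, since the errors stay symmetric,
  and is rare enough to be absorbed for every \<open>R\<close>.

  Markov's inequality for the number of \<open>m\<close>-subsets of bad coordinates then bounds, with failure
  probability \<open>|S|^-(d+1)\<close>, the number of coordinates whose squared error exceeds
  \<open>l/2\<close> times the target average by \<open>|S|/(l(l+1))\<close>. Summing over the levels \<open>l\<close> gives the
  bound; the top level is excluded by a union bound over \<open>S\<close>, which is where \<open>log k \<le> A R\<close> enters.
\<close>

subsection \<open>Sums over product spaces\<close>

lemma sum_PiE_Un:
  fixes F :: "('a \<Rightarrow> 'b) \<Rightarrow> real"
  assumes "A \<inter> B = {}"
  shows "(\<Sum>\<omega>\<in>(A \<union> B) \<rightarrow>\<^sub>E V. F \<omega>) =
    (\<Sum>\<alpha>\<in>A \<rightarrow>\<^sub>E V. \<Sum>\<beta>\<in>B \<rightarrow>\<^sub>E V. F (\<lambda>j. if j \<in> A then \<alpha> j else \<beta> j))"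
  unfolding sum.cartesian_product
  by (rule sum.reindex_bij_witness[where i = "\<lambda>(\<alpha>, \<beta>) j. if j \<in> A then \<alpha> j else \<beta> j"
        and j = "\<lambda>\<omega>. (restrict \<omega> A, restrict \<omega> B)"])
     (use assms in \<open>auto simp: PiE_def Pi_def extensional_def fun_eq_iff intro!: arg_cong[where f = F]\<close>)

text \<open>Assignments are grouped by the set \<open>J1\<close> of coordinates landing in bucket
  \<open>v\<close>; what is left is an arbitrary assignment of the others to the remaining buckets.
  Revealing one bucket in \<open>buckets_product_le\<close> uses this grouping.\<close>

lemma sum_PiE_fibre:
  fixes F :: "('a \<Rightarrow> 'b) \<Rightarrow> real"
  assumes "finite J" "finite W" "v \<in> W"
  shows "(\<Sum>a\<in>J \<rightarrow>\<^sub>E W. F a) =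
    (\<Sum>J1\<in>Pow J. \<Sum>a\<in>(J - J1) \<rightarrow>\<^sub>E (W - {v}). F (\<lambda>j. if j \<in> J1 then v else a j))"
proof -
  have fin: "finite (Pow J)" "\<And>J1. finite ((J - J1) \<rightarrow>\<^sub>E (W - {v}))"
    using assms by (auto intro!: finite_PiE)
  show ?thesis
    by (subst sum.Sigma, use fin in simp, use fin in simp,
        rule sum.reindex_bij_witness[where i = "\<lambda>(J1, a) j. if j \<in> J1 then v else a j"
        and j = "\<lambda>\<omega>. ({j \<in> J. \<omega> j = v}, restrict \<omega> (J - {j \<in> J. \<omega> j = v}))"])
     (use assms in \<open>auto simp: PiE_def Pi_def extensional_def fun_eq_iff split: if_splits intro!: arg_cong[where f = F]\<close>)
qed

subsection \<open>Noise in a single bucket\<close>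

text \<open>\<open>bexp x \<theta> J f\<close> is the expectation of \<open>f (\<Sum>j\<in>J. \<beta>\<^sub>j \<sigma>\<^sub>j x\<^sub>j)\<close> and \<open>ber x q J f\<close> that of
  \<open>f (\<Sum>j\<in>J. \<beta>\<^sub>j x\<^sub>j)\<close>, for independent Bernoulli \<open>\<beta>\<^sub>j\<close> (with parameter \<open>\<theta>\<close>, resp. \<open>q\<close>) and signs \<open>\<sigma>\<^sub>j\<close>.\<close>

definition bexp :: "('a \<Rightarrow> real) \<Rightarrow> real \<Rightarrow> 'a set \<Rightarrow> (real \<Rightarrow> real) \<Rightarrow> real" where
  "bexp x \<theta> J f = (\<Sum>I\<in>Pow J. (\<theta> / 2) ^ card I * (1 - \<theta>) ^ card (J - I) *
      (\<Sum>b\<in>I \<rightarrow>\<^sub>E {-1, 1}. f (\<Sum>j\<in>I. b j * x j)))"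

definition ber :: "('a \<Rightarrow> real) \<Rightarrow> real \<Rightarrow> 'a set \<Rightarrow> (real \<Rightarrow> real) \<Rightarrow> real" where
  "ber x q J f = (\<Sum>I\<in>Pow J. q ^ card I * (1 - q) ^ card (J - I) * f (\<Sum>j\<in>I. x j))"

section \<open>Recursions and moments for signed and unsigned Bernoulli sums\<close>

lemma bexp_empty [simp]: "bexp x \<theta> {} f = f 0"
  by (simp add: bexp_def)

lemma ber_empty [simp]: "ber x \<theta> {} f = f 0"
  by (simp add: ber_def)

lemma sum_Pow_insert:
  fixes F :: "'a set \<Rightarrow> real"
  assumes "finite J" "j \<notin> J"
  shows "(\<Sum>I\<in>Pow (insert j J). F I) = (\<Sum>I\<in>Pow J. F I) + (\<Sum>I\<in>Pow J. F (insert j I))"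
proof -
  have inj: "inj_on (insert j) (Pow J)"
    using assms(2) by (auto intro!: inj_onI)
  show ?thesis
    unfolding Pow_insert
    by (subst sum.union_disjoint) (use assms in \<open>auto simp: sum.reindex[OF inj]\<close>)
qed

lemma ber_insert:
  assumes "finite J" "j \<notin> J"
  shows "ber x q (insert j J) f = (1 - q) * ber x q J f + q * ber x q J (\<lambda>y. f (y + x j))"
proof -
  have fin: "finite I" "j \<notin> I" if "I \<in> Pow J" for I
    using that assms finite_subset by auto
  have "insert j J - I = insert j (J - I)" "insert j J - insert j I = J - I" if "I \<in> Pow J" for I
    using that assms by auto
  thus ?thesis
    unfolding ber_def sum_Pow_insert[OF assms] sum_distrib_left
    using assms fin
    by (intro arg_cong2[where f = "(+)"] sum.cong refl) (simp_all add: algebra_simps)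
qed

lemma sum_PiE_insert_signs:
  fixes F :: "('a \<Rightarrow> real) \<Rightarrow> real"
  assumes "finite I" "j \<notin> I"
  shows "(\<Sum>b\<in>insert j I \<rightarrow>\<^sub>E {-1, 1}. F b) = (\<Sum>b\<in>I \<rightarrow>\<^sub>E {-1, 1}. F (b(j := 1)) + F (b(j := - 1)))"
proof -
  have inj: "inj_on (\<lambda>(y, g). g(j := y)) ({-1, 1 :: real} \<times> (I \<rightarrow>\<^sub>E {-1, 1}))"
    using inj_combinator[of j I "\<lambda>_. {-1, 1 :: real}"] assms by simp
  have "(\<Sum>b\<in>insert j I \<rightarrow>\<^sub>E {-1, 1}. F b) = (\<Sum>(y, b)\<in>{-1, 1} \<times> (I \<rightarrow>\<^sub>E {-1, 1}). F (b(j := y)))"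
    unfolding PiE_insert_eq by (subst sum.reindex[OF inj]) (simp add: case_prod_unfold comp_def)
  also have "\<dots> = (\<Sum>b\<in>I \<rightarrow>\<^sub>E {-1, 1}. F (b(j := 1)) + F (b(j := - 1)))"
    by (simp flip: sum.cartesian_product add: sum.distrib add.commute)
  finally show ?thesis .
qed

lemma bexp_insert:
  assumes "finite J" "j \<notin> J"
  shows "bexp x \<theta> (insert j J) f =
    (1 - \<theta>) * bexp x \<theta> J f + \<theta> / 2 * (bexp x \<theta> J (\<lambda>y. f (y + x j)) + bexp x \<theta> J (\<lambda>y. f (y - x j)))"
proof -
  have fin: "finite I" "j \<notin> I" if "I \<in> Pow J" for I
    using that assms finite_subset by auto
  have eq: "insert j J - I = insert j (J - I)" "insert j J - insert j I = J - I" if "I \<in> Pow J" for I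
    using that assms by auto
  have s: "(\<Sum>b\<in>insert j I \<rightarrow>\<^sub>E {-1, 1}. f (\<Sum>i\<in>insert j I. b i * x i)) =
     (\<Sum>b\<in>I \<rightarrow>\<^sub>E {-1, 1}. f ((\<Sum>i\<in>I. b i * x i) + x j)) + (\<Sum>b\<in>I \<rightarrow>\<^sub>E {-1, 1}. f ((\<Sum>i\<in>I. b i * x i) - x j))"
    if "I \<in> Pow J" for I
  proof -
    have "(\<Sum>i\<in>insert j I. (b(j := y)) i * x i) = (\<Sum>i\<in>I. b i * x i) + y * x j" for b y
    proof -
      have "(\<Sum>i\<in>I. (b(j := y)) i * x i) = (\<Sum>i\<in>I. b i * x i)"
        using fin[OF that] by (intro sum.cong) auto
      thus ?thesis using fin[OF that] by simp
    qed
    thus ?thesis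
      by (subst sum_PiE_insert_signs[OF fin[OF that]]) (simp add: sum.distrib)
  qed
  define K where "K I g = (\<Sum>b\<in>I \<rightarrow>\<^sub>E {-1, 1}. g (\<Sum>i\<in>I. b i * x i))" for I :: "'a set" and g :: "real \<Rightarrow> real"
  have bx: "bexp x \<theta> J g = (\<Sum>I\<in>Pow J. (\<theta> / 2) ^ card I * (1 - \<theta>) ^ card (J - I) * K I g)" for J g
    by (simp add: bexp_def K_def)
  have K: "K (insert j I) f = K I (\<lambda>y. f (y + x j)) + K I (\<lambda>y. f (y - x j))" if "I \<in> Pow J" for I
    unfolding K_def by (rule s[OF that])
  have "bexp x \<theta> (insert j J) f =
      (\<Sum>I\<in>Pow J. (1 - \<theta>) * ((\<theta> / 2) ^ card I * (1 - \<theta>) ^ card (J - I) * K I f)) +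
      (\<Sum>I\<in>Pow J. \<theta> / 2 * ((\<theta> / 2) ^ card I * (1 - \<theta>) ^ card (J - I) * K I (\<lambda>y. f (y + x j)))
        + \<theta> / 2 * ((\<theta> / 2) ^ card I * (1 - \<theta>) ^ card (J - I) * K I (\<lambda>y. f (y - x j))))"
    unfolding bx sum_Pow_insert[OF assms]
    by (intro arg_cong2[where f = "(+)"] sum.cong refl)
       (use assms fin in \<open>simp_all add: K eq distrib_left mult_ac\<close>)
  thus ?thesis
    unfolding bx by (simp add: sum.distrib sum_distrib_left distrib_left)
qed

lemma bexp_mono:
  assumes "0 \<le> \<theta>" "\<theta> \<le> 1" "\<And>y. f y \<le> g y"
  shows "bexp x \<theta> J f \<le> bexp x \<theta> J g"
  unfolding bexp_def using assms by (intro sum_mono mult_left_mono sum_mono) auto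

lemma bexp_add: "bexp x \<theta> J (\<lambda>y. f y + g y) = bexp x \<theta> J f + bexp x \<theta> J g"
  by (simp add: bexp_def sum.distrib distrib_left)

lemma bexp_cmult: "bexp x \<theta> J (\<lambda>y. a * f y) = a * bexp x \<theta> J f"
  unfolding bexp_def sum_distrib_left by (intro sum.cong) (simp_all add: sum_distrib_left mult_ac)

lemma bexp_const:
  assumes "finite J"
  shows "bexp x \<theta> J (\<lambda>_. a) = a"
  using assms by (induction J) (auto simp: bexp_insert algebra_simps)

lemma bexp_nonneg:
  assumes "0 \<le> \<theta>" "\<theta> \<le> 1" "\<And>y. 0 \<le> f y"
  shows "0 \<le> bexp x \<theta> J f"
  unfolding bexp_def using assms by (intro sum_nonneg mult_nonneg_nonneg) auto

text \<open>The shift \<open>a\<close> carries the induction: conditioning on coordinate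
  \<open>j\<close> moves the centre by \<open>x j\<close>, \<open>- x j\<close> or not at all, and
  the cross terms of the two signs cancel.\<close>

lemma bexp_square:
  assumes "finite J"
  shows "bexp x \<theta> J (\<lambda>y. (y + a)\<^sup>2) = a\<^sup>2 + \<theta> * (\<Sum>j\<in>J. (x j)\<^sup>2)"
  using assms
proof (induction J arbitrary: a)
  case (insert j J)
  have "bexp x \<theta> J (\<lambda>y. (y + x j + a)\<^sup>2) = (x j + a)\<^sup>2 + \<theta> * (\<Sum>j\<in>J. (x j)\<^sup>2)"
    "bexp x \<theta> J (\<lambda>y. (y - x j + a)\<^sup>2) = (- x j + a)\<^sup>2 + \<theta> * (\<Sum>j\<in>J. (x j)\<^sup>2)"
    using insert.IH[of "x j + a"] insert.IH[of "- x j + a"] by (simp_all add: algebra_simps)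
  thus ?case
    using insert by (simp add: bexp_insert) (simp add: power2_eq_square algebra_simps)
qed simp

lemma bexp_zero:
  assumes "finite J" "\<And>j. j \<in> J \<Longrightarrow> x j = 0"
  shows "bexp x \<theta> J f = f 0"
  using assms by (induction J) (auto simp: bexp_insert algebra_simps)

text \<open>Chebyshev with the variance bound multiplied out, so that \<epsilon> = 0 is covered: the
  hypothesis then forces \<open>x\<close> to vanish on \<open>J\<close>. Otherwise the indicator is
  bounded below pointwise by 1 - y^2/\<epsilon>^2.\<close>

lemma bexp_chebyshev:
  assumes "finite J" "0 < \<theta>" "\<theta> \<le> 1" "0 \<le> \<epsilon>" "0 \<le> \<eta>" "\<theta> * (\<Sum>j\<in>J. (x j)\<^sup>2) \<le> \<eta> * \<epsilon>\<^sup>2"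
  shows "1 - \<eta> \<le> bexp x \<theta> J (\<lambda>y. of_bool (\<bar>y\<bar> \<le> \<epsilon>))"
proof (cases "\<epsilon> = 0")
  case True
  hence "(\<Sum>j\<in>J. (x j)\<^sup>2) \<le> 0"
    using assms by (simp add: mult_le_0_iff)
  hence "(\<Sum>j\<in>J. (x j)\<^sup>2) = 0"
    by (intro antisym sum_nonneg) auto
  hence "x j = 0" if "j \<in> J" for j
    using that assms(1) by (auto simp: sum_nonneg_eq_0_iff)
  thus ?thesis
    using assms by (subst bexp_zero) auto
next
  case False
  have "bexp x \<theta> J (\<lambda>y. 1 + (- inverse (\<epsilon>\<^sup>2)) * (y + 0)\<^sup>2) \<le> bexp x \<theta> J (\<lambda>y. of_bool (\<bar>y\<bar> \<le> \<epsilon>))"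
  proof (rule bexp_mono)
    fix y
    have "\<epsilon>\<^sup>2 \<le> y\<^sup>2" if "\<not> \<bar>y\<bar> \<le> \<epsilon>"
      using that assms by (simp add: abs_le_square_iff[symmetric])
    thus "1 + - inverse (\<epsilon>\<^sup>2) * (y + 0)\<^sup>2 \<le> of_bool (\<bar>y\<bar> \<le> \<epsilon>)"
      using False by (auto simp: field_simps)
  qed (use assms in auto)
  also have "bexp x \<theta> J (\<lambda>y. 1 + (- inverse (\<epsilon>\<^sup>2)) * (y + 0)\<^sup>2) = 1 - \<theta> * (\<Sum>j\<in>J. (x j)\<^sup>2) / \<epsilon>\<^sup>2"
    unfolding bexp_add bexp_cmult bexp_square[OF assms(1)] bexp_const[OF assms(1)]
    by (simp add: field_simps)
  moreover have "\<theta> * (\<Sum>j\<in>J. (x j)\<^sup>2) / \<epsilon>\<^sup>2 \<le> \<eta>"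
    using assms False by (simp add: pos_divide_le_eq)
  ultimately show ?thesis by linarith
qed

text \<open>With probability (1 - \<theta>)^|I| no coordinate of \<open>I\<close> falls into the
  bucket, and then only \<open>J\<close> contributes. The other outcomes are dropped because
  \<open>f\<close> is nonnegative.\<close>

lemma bexp_Un_ge:
  assumes "finite I" "finite J" "I \<inter> J = {}" "0 \<le> \<theta>" "\<theta> \<le> 1" "\<And>y. 0 \<le> f y"
  shows "(1 - \<theta>) ^ card I * bexp x \<theta> J f \<le> bexp x \<theta> (I \<union> J) f"
  using assms(1,3)
proof (induction I)
  case (insert i I)
  have "(1 - \<theta>) ^ card (insert i I) * bexp x \<theta> J f = (1 - \<theta>) * ((1 - \<theta>) ^ card I * bexp x \<theta> J f)"
    using insert by simp
  also have "\<dots> \<le> (1 - \<theta>) * bexp x \<theta> (I \<union> J) f"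
    using insert assms by (intro mult_left_mono) auto
  also have "\<dots> \<le> bexp x \<theta> (insert i (I \<union> J)) f"
    using insert.hyps insert.prems assms
    by (subst bexp_insert) (auto intro!: mult_nonneg_nonneg add_nonneg_nonneg bexp_nonneg)
  finally show ?case by simp
qed simp

lemma ber_add: "ber x q J (\<lambda>y. f y + g y) = ber x q J f + ber x q J g"
  by (simp add: ber_def sum.distrib distrib_left)

lemma ber_cmult: "ber x q J (\<lambda>y. a * f y) = a * ber x q J f"
  unfolding ber_def sum_distrib_left by (intro sum.cong) (simp_all add: sum_distrib_left mult_ac)

lemma ber_const:
  assumes "finite J"
  shows "ber x q J (\<lambda>_. a) = a"
  using assms by (induction J) (auto simp: ber_insert algebra_simps)

lemma ber_square:
  assumes "finite J"
  shows "ber x q J (\<lambda>y. (y + a - q * (\<Sum>j\<in>J. x j))\<^sup>2) = a\<^sup>2 + q * (1 - q) * (\<Sum>j\<in>J. (x j)\<^sup>2)"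
  using assms
proof (induction J arbitrary: a)
  case (insert j J)
  have "ber x q J (\<lambda>y. (y + a - q * (x j + sum x J))\<^sup>2) = (a - q * x j)\<^sup>2 + q * (1 - q) * (\<Sum>j\<in>J. (x j)\<^sup>2)"
    "ber x q J (\<lambda>y. (y + x j + a - q * (x j + sum x J))\<^sup>2) = (a + (1 - q) * x j)\<^sup>2 + q * (1 - q) * (\<Sum>j\<in>J. (x j)\<^sup>2)"
    using insert.IH[of "a - q * x j"] insert.IH[of "a + (1 - q) * x j"] by (simp_all add: algebra_simps)
  thus ?case
    using insert by (simp add: ber_insert) (simp add: power2_eq_square algebra_simps)
qed simp

text \<open>A signed Bernoulli variable with parameter \<open>\<theta>\<close> is the difference of two independent
  Bernoulli variables with parameter \<open>q\<close> when \<open>2q(1-q) = \<theta>\<close>.\<close>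

lemma bexp_eq_ber_diff:
  assumes "finite J" "2 * q * (1 - q) = \<theta>"
  shows "bexp x \<theta> J f = ber x q J (\<lambda>a. ber x q J (\<lambda>b. f (a - b)))"
  using assms(1)
proof (induction J arbitrary: f)
  case (insert j J)
  have r: "ber x q (insert j J) g = (1 - q) * ber x q J g + q * ber x q J (\<lambda>y. g (y + x j))" for g
    using insert by (simp add: ber_insert)
  have *: "\<theta> / 2 = q * (1 - q)" "1 - \<theta> = (1 - q) * (1 - q) + q * q"
    unfolding assms(2)[symmetric] by (simp_all add: field_simps)
  have **: "a + x j - (b + x j) = a - b" "a + x j - b = a - b + x j" "a - (b + x j) = a - b - x j"  for a b
    by auto
  show ?case
    unfolding bexp_insert[OF insert.hyps] r ber_add ber_cmult insert.IH * **
    by (simp add: algebra_simps)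
qed simp

text \<open>By Chebyshev, mass at least 3/4 lies within 2s of \<mu>. That interval is covered by at
  most 5/r cells of width \<epsilon>, and by Cauchy-Schwarz two independent copies share a cell with
  probability at least (9/16)(r/5), which exceeds r/10.\<close>

lemma coincidence_prob_ge:
  fixes A :: "'b \<Rightarrow> real" and w :: "'b \<Rightarrow> real"
  assumes "finite \<Omega>" "\<And>\<omega>. \<omega> \<in> \<Omega> \<Longrightarrow> 0 \<le> w \<omega>" "(\<Sum>\<omega>\<in>\<Omega>. w \<omega>) = 1"
    and var: "(\<Sum>\<omega>\<in>\<Omega>. w \<omega> * (A \<omega> - \<mu>)\<^sup>2) \<le> s\<^sup>2" and "0 < s" "0 < \<epsilon>" "0 < r" "r \<le> 1" "r * s \<le> \<epsilon>"
  shows "r / 10 \<le> (\<Sum>\<omega>\<in>\<Omega>. w \<omega> * (\<Sum>\<omega>'\<in>\<Omega>. w \<omega>' * of_bool (\<bar>A \<omega> - A \<omega>'\<bar> \<le> \<epsilon>)))"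
proof -
  define G where "G = {\<omega>\<in>\<Omega>. \<bar>A \<omega> - \<mu>\<bar> \<le> 2 * s}"
  define cell where "cell \<omega> = nat \<lfloor>(A \<omega> - \<mu> + 2 * s) / \<epsilon>\<rfloor>" for \<omega>
  define N where "N = nat \<lfloor>4 * s / \<epsilon>\<rfloor> + 1"
  have finG: "finite G" "G \<subseteq> \<Omega>"
    using assms by (auto simp: G_def)
  have cellG: "cell ` G \<subseteq> {..<N}"
  proof safe
    fix \<omega> assume "\<omega> \<in> G"
    hence "(A \<omega> - \<mu> + 2 * s) / \<epsilon> \<le> 4 * s / \<epsilon>"
      using assms by (intro divide_right_mono) (auto simp: G_def)
    hence "\<lfloor>(A \<omega> - \<mu> + 2 * s) / \<epsilon>\<rfloor> \<le> \<lfloor>4 * s / \<epsilon>\<rfloor>"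
      by (rule floor_mono)
    thus "cell \<omega> < N"
      unfolding cell_def N_def by linarith
  qed
  have close: "\<bar>A \<omega> - A \<omega>'\<bar> \<le> \<epsilon>" if "\<omega> \<in> G" "\<omega>' \<in> G" "cell \<omega> = cell \<omega>'" for \<omega> \<omega>'
  proof -
    have "0 \<le> (A \<omega> - \<mu> + 2 * s) / \<epsilon>" "0 \<le> (A \<omega>' - \<mu> + 2 * s) / \<epsilon>"
      using that assms by (auto simp: G_def)
    hence "\<lfloor>(A \<omega> - \<mu> + 2 * s) / \<epsilon>\<rfloor> = \<lfloor>(A \<omega>' - \<mu> + 2 * s) / \<epsilon>\<rfloor>"
      using that(3) unfolding cell_def by (simp add: eq_nat_nat_iff)
    hence "\<bar>(A \<omega> - \<mu> + 2 * s) / \<epsilon> - (A \<omega>' - \<mu> + 2 * s) / \<epsilon>\<bar> \<le> 1"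
      by linarith
    also have "(A \<omega> - \<mu> + 2 * s) / \<epsilon> - (A \<omega>' - \<mu> + 2 * s) / \<epsilon> = (A \<omega> - A \<omega>') / \<epsilon>"
      using assms by (simp add: field_simps)
    finally show ?thesis
      using assms by (simp add: field_simps)
  qed
  have "3 / 4 \<le> (\<Sum>\<omega>\<in>G. w \<omega>)"
  proof -
    have "(\<Sum>\<omega>\<in>\<Omega> - G. w \<omega>) * (4 * s\<^sup>2) \<le> (\<Sum>\<omega>\<in>\<Omega> - G. w \<omega> * (A \<omega> - \<mu>)\<^sup>2)"
      unfolding sum_distrib_right
    proof (intro sum_mono mult_left_mono)
      fix \<omega> assume "\<omega> \<in> \<Omega> - G"
      hence "\<bar>2 * s\<bar> \<le> \<bar>A \<omega> - \<mu>\<bar>"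
        using assms by (auto simp: G_def)
      thus "4 * s\<^sup>2 \<le> (A \<omega> - \<mu>)\<^sup>2"
        by (simp add: abs_le_square_iff power_mult_distrib)
    qed (use assms in auto)
    also have "\<dots> \<le> (\<Sum>\<omega>\<in>\<Omega>. w \<omega> * (A \<omega> - \<mu>)\<^sup>2)"
      using assms by (intro sum_mono2) auto
    also note var
    finally have "(\<Sum>\<omega>\<in>\<Omega> - G. w \<omega>) * 4 \<le> 1"
      using assms by simp
    thus ?thesis
      using assms(1,3) finG sum.subset_diff[of G \<Omega> w] by simp
  qed
  hence "(3 / 4)\<^sup>2 \<le> (\<Sum>\<omega>\<in>G. w \<omega>)\<^sup>2"
    by (intro power_mono) auto
  \<comment> \<open>The squared mass is split over the cells; Cauchy-Schwarz then turns it into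
    \<open>N\<close> times the probability that two copies share a cell.\<close>
  also have "(\<Sum>\<omega>\<in>G. w \<omega>) = (\<Sum>v<N. \<Sum>\<omega>\<in>{\<omega>\<in>G. cell \<omega> = v}. w \<omega>)"
    using sum.group[OF finG(1) _ cellG, of w] by simp
  also have "\<dots>\<^sup>2 \<le> (\<Sum>v<N. (\<Sum>\<omega>\<in>{\<omega>\<in>G. cell \<omega> = v}. w \<omega>)\<^sup>2) * real N"
    using sum_squared_le_sum_of_squares[of "\<lambda>v. \<Sum>\<omega>\<in>{\<omega>\<in>G. cell \<omega> = v}. w \<omega>" "{..<N}"] by simp
  also have "(\<Sum>v<N. (\<Sum>\<omega>\<in>{\<omega>\<in>G. cell \<omega> = v}. w \<omega>)\<^sup>2)
      = (\<Sum>v<N. \<Sum>\<omega>\<in>{\<omega>\<in>G. cell \<omega> = v}. w \<omega> * (\<Sum>\<omega>'\<in>G. w \<omega>' * of_bool (cell \<omega> = cell \<omega>')))"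
    unfolding power2_eq_square sum_distrib_right
  proof (intro sum.cong refl)
    fix v \<omega> assume "\<omega> \<in> {\<omega>\<in>G. cell \<omega> = v}"
    thus "w \<omega> * (\<Sum>\<omega>'\<in>{\<omega>\<in>G. cell \<omega> = v}. w \<omega>') = w \<omega> * (\<Sum>\<omega>'\<in>G. w \<omega>' * of_bool (cell \<omega> = cell \<omega>'))"
      using finG by (intro arg_cong[where f = "\<lambda>y. w \<omega> * y"] sum.mono_neutral_cong_left) auto
  qed
  also have "\<dots> = (\<Sum>\<omega>\<in>G. w \<omega> * (\<Sum>\<omega>'\<in>G. w \<omega>' * of_bool (cell \<omega> = cell \<omega>')))"
    using sum.group[OF finG(1) _ cellG, of "\<lambda>\<omega>. w \<omega> * (\<Sum>\<omega>'\<in>G. w \<omega>' * of_bool (cell \<omega> = cell \<omega>'))"] by simp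
  also have "\<dots> * real N \<le> (\<Sum>\<omega>\<in>G. w \<omega> * (\<Sum>\<omega>'\<in>G. w \<omega>' * of_bool (\<bar>A \<omega> - A \<omega>'\<bar> \<le> \<epsilon>))) * real N"
    using close finG assms by (intro mult_right_mono sum_mono mult_left_mono) auto
  also have "\<dots> \<le> (\<Sum>\<omega>\<in>\<Omega>. w \<omega> * (\<Sum>\<omega>'\<in>\<Omega>. w \<omega>' * of_bool (\<bar>A \<omega> - A \<omega>'\<bar> \<le> \<epsilon>))) * real N"
    (is "?L \<le> ?X * _")
  proof (intro mult_right_mono)
    have "(\<Sum>\<omega>\<in>G. w \<omega> * (\<Sum>\<omega>'\<in>G. w \<omega>' * of_bool (\<bar>A \<omega> - A \<omega>'\<bar> \<le> \<epsilon>)))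
      \<le> (\<Sum>\<omega>\<in>G. w \<omega> * (\<Sum>\<omega>'\<in>\<Omega>. w \<omega>' * of_bool (\<bar>A \<omega> - A \<omega>'\<bar> \<le> \<epsilon>)))"
      using assms finG by (intro sum_mono mult_left_mono sum_mono2) auto
    also have "\<dots> \<le> ?X"
      using assms finG by (intro sum_mono2) (auto intro!: mult_nonneg_nonneg sum_nonneg)
    finally show "(\<Sum>\<omega>\<in>G. w \<omega> * (\<Sum>\<omega>'\<in>G. w \<omega>' * of_bool (\<bar>A \<omega> - A \<omega>'\<bar> \<le> \<epsilon>))) \<le> ?X" .
  qed auto
  finally have *: "(3 / 4)\<^sup>2 \<le> ?X * real N" .
  have "4 * s / \<epsilon> \<le> 4 / r"
    using assms by (simp add: field_simps)
  moreover have "real N \<le> 4 * s / \<epsilon> + 1"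
    using assms unfolding N_def by simp
  moreover have "1 \<le> 1 / r"
    using assms by simp
  ultimately have N: "real N \<le> 5 / r"
    by linarith
  have "0 \<le> ?X"
    using assms by (intro sum_nonneg mult_nonneg_nonneg) auto
  hence "?X * real N \<le> ?X * (5 / r)"
    using N by (rule mult_left_mono[rotated])
  with * have "(3 / 4)\<^sup>2 \<le> ?X * (5 / r)" by linarith
  thus ?thesis
    using assms by (simp add: field_simps power2_eq_square)
qed

text \<open>The noise is a difference of two independent Bernoulli sums, so being small means that
  two copies nearly coincide. Only the second moment enters, so a few dominating coordinates do no
  harm; zero variance is treated separately.\<close>

lemma bexp_anticoncentration:
  assumes "finite J" "0 < \<theta>" "\<theta> \<le> 1 / 2" "0 \<le> \<epsilon>" "0 < r" "r \<le> 1" "r\<^sup>2 * (\<theta> * (\<Sum>j\<in>J. (x j)\<^sup>2)) \<le> \<epsilon>\<^sup>2"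
  shows "r / 10 \<le> bexp x \<theta> J (\<lambda>y. of_bool (\<bar>y\<bar> \<le> \<epsilon>))"
proof (cases "\<theta> * (\<Sum>j\<in>J. (x j)\<^sup>2) = 0")
  case True
  thus ?thesis
    using bexp_chebyshev[OF assms(1,2) _ assms(4), of 0 x] assms by simp
next
  case False
  define s where "s = sqrt (\<theta> * (\<Sum>j\<in>J. (x j)\<^sup>2))"
  have "0 \<le> \<theta> * (\<Sum>j\<in>J. (x j)\<^sup>2)"
    using assms by (auto intro!: mult_nonneg_nonneg sum_nonneg)
  hence "0 < \<theta> * (\<Sum>j\<in>J. (x j)\<^sup>2)"
    using False by linarith
  hence s: "0 < s" "s\<^sup>2 = \<theta> * (\<Sum>j\<in>J. (x j)\<^sup>2)"
    unfolding s_def by simp_all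
  have rs: "r * s \<le> \<epsilon>"
    using power2_le_imp_le[of "r * s" \<epsilon>] assms(4,7) unfolding power_mult_distrib s(2) by blast
  hence eps: "0 < \<epsilon>"
    using s assms by (smt (verit) mult_pos_pos)
  \<comment> \<open>The smaller root of 2q(1-q) = \<theta>, which is real because \<theta> \<le>
    1/2. Each of the two copies then has half the variance of the difference.\<close>
  define q where "q = (1 - sqrt (1 - 2 * \<theta>)) / 2"
  have "sqrt (1 - 2 * \<theta>) \<le> 1" "0 \<le> sqrt (1 - 2 * \<theta>)" "(sqrt (1 - 2 * \<theta>))\<^sup>2 = 1 - 2 * \<theta>"
    using assms by auto
  hence q: "0 \<le> q" "q \<le> 1" "2 * q * (1 - q) = \<theta>"
    unfolding q_def by (auto simp: field_simps power2_eq_square)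
  define w where "w I = q ^ card I * (1 - q) ^ card (J - I)" for I
  have w: "\<And>f. ber x q J f = (\<Sum>I\<in>Pow J. w I * f (sum x I))" "\<And>I. 0 \<le> w I"
    using q by (simp_all add: ber_def w_def)
  have "r / 10 \<le> (\<Sum>\<omega>\<in>Pow J. w \<omega> * (\<Sum>\<omega>'\<in>Pow J. w \<omega>' * of_bool (\<bar>sum x \<omega> - sum x \<omega>'\<bar> \<le> \<epsilon>)))"
  proof (rule coincidence_prob_ge)
    show "(\<Sum>I\<in>Pow J. w I) = 1"
      using w(1)[of "\<lambda>_. 1"] ber_const[OF assms(1), of x q 1] by simp
    have "(\<Sum>I\<in>Pow J. w I * (sum x I - q * (\<Sum>j\<in>J. x j))\<^sup>2) = q * (1 - q) * (\<Sum>j\<in>J. (x j)\<^sup>2)"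
      using w(1)[of "\<lambda>y. (y + 0 - q * (\<Sum>j\<in>J. x j))\<^sup>2"] ber_square[OF assms(1), of x q 0] by simp
    also have "\<dots> = s\<^sup>2 / 2"
      unfolding s(2) q(3)[symmetric] by simp
    also have "\<dots> \<le> s\<^sup>2"
      by simp
    finally show "(\<Sum>I\<in>Pow J. w I * (sum x I - q * (\<Sum>j\<in>J. x j))\<^sup>2) \<le> s\<^sup>2" .
  qed (use assms s rs eps w in auto)
  also have "\<dots> = bexp x \<theta> J (\<lambda>y. of_bool (\<bar>y\<bar> \<le> \<epsilon>))"
    unfolding bexp_eq_ber_diff[OF assms(1) q(3)] w(1) ..
  finally show ?thesis .
qed

subsection \<open>Several buckets\<close>

text \<open>The buckets in \<open>V\<close> are revealed one at a time: conditionally on the contents of the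
  buckets seen so far, the remaining coordinates are uniform on the remaining buckets.\<close>

lemma buckets_product_le:
  fixes f :: "real \<Rightarrow> real"
  assumes "finite V" "finite W" "V \<subseteq> W" "finite J" "\<And>y. 0 \<le> f y" "0 \<le> \<rho>"
    and "\<And>I C'. I \<subseteq> J \<Longrightarrow> card W - card V < C' \<Longrightarrow> C' \<le> card W \<Longrightarrow> bexp x (1 / real C') I f \<le> \<rho>"
  shows "(\<Sum>a\<in>J \<rightarrow>\<^sub>E W. \<Sum>b\<in>J \<rightarrow>\<^sub>E {-1, 1}. \<Prod>v\<in>V. f (\<Sum>j\<in>{j\<in>J. a j = v}. b j * x j))
     \<le> (2 * real (card W)) ^ card J * \<rho> ^ card V"
  using assms
proof (induction V arbitrary: W J)
  case empty
  thus ?case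
    by (simp add: card_PiE card_funcsetE power_mult_distrib numeral_2_eq_2 mult.commute)
next
  case (insert v V)
  let ?N = "card W"
  have N: "card (W - {v}) = ?N - 1" "0 < ?N"
    using insert.prems by (auto simp: card_gt_0_iff)
  have VW: "card (insert v V) \<le> ?N"
    using insert.prems by (intro card_mono) auto
  have IH: "(\<Sum>a\<in>(J - I) \<rightarrow>\<^sub>E (W - {v}). \<Sum>b\<in>(J - I) \<rightarrow>\<^sub>E {-1, 1}.
      \<Prod>v\<in>V. f (\<Sum>j\<in>{j\<in>J - I. a j = v}. b j * x j)) \<le> (2 * real (?N - 1)) ^ card (J - I) * \<rho> ^ card V"
    if "I \<subseteq> J" for I
  proof -
    \<comment> \<open>Deleting \<open>v\<close> lowers both the bucket count and the number of
      buckets still to be revealed by one, so the admissible range of \<open>C'\<close> only loses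
      its top value.\<close>
    have "bexp x (1 / real C') I' f \<le> \<rho>"
      if "I' \<subseteq> J - I" "card (W - {v}) - card V < C'" "C' \<le> card (W - {v})" for I' C'
      using that insert.hyps N by (intro insert.prems) auto
    moreover have "V \<subseteq> W - {v}"
      using insert.prems insert.hyps by auto
    ultimately show ?thesis
      using insert.IH[of "W - {v}" "J - I"] insert.prems N(1) by simp
  qed
  have "(\<Sum>a\<in>J \<rightarrow>\<^sub>E W. \<Sum>b\<in>J \<rightarrow>\<^sub>E {-1, 1}. \<Prod>v\<in>insert v V. f (\<Sum>j\<in>{j\<in>J. a j = v}. b j * x j))
    = (\<Sum>I\<in>Pow J. \<Sum>a\<in>(J - I) \<rightarrow>\<^sub>E (W - {v}). \<Sum>b\<in>J \<rightarrow>\<^sub>E {-1, 1}.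
        f (\<Sum>j\<in>I. b j * x j) * (\<Prod>v\<in>V. f (\<Sum>j\<in>{j\<in>J - I. a j = v}. b j * x j)))"
  proof (subst sum_PiE_fibre[of J W v], goal_cases)
    case 4
    show ?case
    proof (intro sum.cong refl)
      fix I a b assume *: "I \<in> Pow J" "a \<in> (J - I) \<rightarrow>\<^sub>E (W - {v})"
      have 1: "{j\<in>J. (if j \<in> I then v else a j) = v} = I"
        using * by (auto simp: PiE_def Pi_def split: if_splits)
      have 2: "{j\<in>J. (if j \<in> I then v else a j) = v'} = {j\<in>J - I. a j = v'}" if "v' \<in> V" for v'
        using * that insert.hyps by (auto split: if_splits)
      show "(\<Prod>v'\<in>insert v V. f (\<Sum>j\<in>{j\<in>J. (if j \<in> I then v else a j) = v'}. b j * x j)) =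
          f (\<Sum>j\<in>I. b j * x j) * (\<Prod>v\<in>V. f (\<Sum>j\<in>{j\<in>J - I. a j = v}. b j * x j))"
        using insert.hyps by (simp add: 1 2 cong: prod.cong)
    qed
  qed (use insert.prems in auto)
  \<comment> \<open>The content of bucket \<open>v\<close> depends only on the signs in
    \<open>I\<close> and the other buckets only on the signs in \<open>J - I\<close>, so the sum
    factors.\<close>
  also have "\<dots> = (\<Sum>I\<in>Pow J. (\<Sum>b\<in>I \<rightarrow>\<^sub>E {-1, 1}. f (\<Sum>j\<in>I. b j * x j)) *
      (\<Sum>a\<in>(J - I) \<rightarrow>\<^sub>E (W - {v}). \<Sum>b\<in>(J - I) \<rightarrow>\<^sub>E {-1, 1}.
        \<Prod>v\<in>V. f (\<Sum>j\<in>{j\<in>J - I. a j = v}. b j * x j)))"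
  proof (rule sum.cong[OF refl])
    fix I assume I: "I \<in> Pow J"
    have "(\<Sum>b\<in>J \<rightarrow>\<^sub>E {-1, 1}. f (\<Sum>j\<in>I. b j * x j) * (\<Prod>v\<in>V. f (\<Sum>j\<in>{j\<in>J - I. a j = v}. b j * x j)))
       = (\<Sum>b\<in>I \<rightarrow>\<^sub>E {-1, 1}. f (\<Sum>j\<in>I. b j * x j)) *
         (\<Sum>b\<in>(J - I) \<rightarrow>\<^sub>E {-1, 1}. \<Prod>v\<in>V. f (\<Sum>j\<in>{j\<in>J - I. a j = v}. b j * x j))" for a
    proof -
      have J: "J = I \<union> (J - I)" using I by auto
      show ?thesis
        by (subst (1) J, subst sum_PiE_Un)
           (auto simp: sum_product intro!: sum.cong prod.cong arg_cong2[where f = "(*)"] arg_cong[where f = f])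
    qed
    thus "(\<Sum>a\<in>(J - I) \<rightarrow>\<^sub>E (W - {v}). \<Sum>b\<in>J \<rightarrow>\<^sub>E {-1, 1}.
        f (\<Sum>j\<in>I. b j * x j) * (\<Prod>v\<in>V. f (\<Sum>j\<in>{j\<in>J - I. a j = v}. b j * x j))) =
      (\<Sum>b\<in>I \<rightarrow>\<^sub>E {-1, 1}. f (\<Sum>j\<in>I. b j * x j)) *
      (\<Sum>a\<in>(J - I) \<rightarrow>\<^sub>E (W - {v}). \<Sum>b\<in>(J - I) \<rightarrow>\<^sub>E {-1, 1}.
        \<Prod>v\<in>V. f (\<Sum>j\<in>{j\<in>J - I. a j = v}. b j * x j))"
      by (simp add: sum_distrib_left)
  qed
  also have "\<dots> \<le> (\<Sum>I\<in>Pow J. (\<Sum>b\<in>I \<rightarrow>\<^sub>E {-1, 1}. f (\<Sum>j\<in>I. b j * x j)) *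
      ((2 * real (?N - 1)) ^ card (J - I) * \<rho> ^ card V))"
    using insert.prems by (intro sum_mono mult_left_mono IH sum_nonneg) auto
  \<comment> \<open>Counts become probabilities: out of (2N)^|J| choices, a coordinate enters bucket
    \<open>v\<close> with a given sign with weight 1/(2N) and avoids it with weight 1 - 1/N. The sum
    over \<open>I\<close> is then \<open>bexp\<close> with parameter 1/N.\<close>
  also have "\<dots> = (\<Sum>I\<in>Pow J. (2 * real ?N) ^ card J * \<rho> ^ card V * ((1 / real ?N / 2) ^ card I *
      (1 - 1 / real ?N) ^ card (J - I) * (\<Sum>b\<in>I \<rightarrow>\<^sub>E {-1, 1}. f (\<Sum>j\<in>I. b j * x j))))"
  proof (rule sum.cong[OF refl])
    fix I assume "I \<in> Pow J"
    hence c: "card J = card I + card (J - I)"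
      using insert.prems by (auto simp: card_Diff_subset finite_subset card_mono)
    have "2 * real ?N * (1 / real ?N / 2) = 1" "2 * real ?N * (1 - 1 / real ?N) = 2 * real (?N - 1)"
      using N(2) by (auto simp: field_simps of_nat_diff)
    hence "(2 * real ?N) ^ card I * (1 / real ?N / 2) ^ card I = 1"
      "(2 * real ?N) ^ card (J - I) * (1 - 1 / real ?N) ^ card (J - I) = (2 * real (?N - 1)) ^ card (J - I)"
      unfolding power_mult_distrib[symmetric] by (simp_all only: power_one)
    moreover have "(2 * real ?N) ^ card J * ((1 / real ?N / 2) ^ card I * (1 - 1 / real ?N) ^ card (J - I))
        = ((2 * real ?N) ^ card I * (1 / real ?N / 2) ^ card I) *
          ((2 * real ?N) ^ card (J - I) * (1 - 1 / real ?N) ^ card (J - I))"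
      unfolding c power_add by (simp only: mult_ac)
    ultimately have *: "(2 * real ?N) ^ card J * ((1 / real ?N / 2) ^ card I * (1 - 1 / real ?N) ^ card (J - I))
        = (2 * real (?N - 1)) ^ card (J - I)"
      by (simp only: mult_1)
    show "(\<Sum>b\<in>I \<rightarrow>\<^sub>E {-1, 1}. f (\<Sum>j\<in>I. b j * x j)) * ((2 * real (?N - 1)) ^ card (J - I) * \<rho> ^ card V) =
      (2 * real ?N) ^ card J * \<rho> ^ card V * ((1 / real ?N / 2) ^ card I * (1 - 1 / real ?N) ^ card (J - I) *
         (\<Sum>b\<in>I \<rightarrow>\<^sub>E {-1, 1}. f (\<Sum>j\<in>I. b j * x j)))"
      unfolding *[symmetric] by (simp only: mult_ac)
  qed
  also have "\<dots> = (2 * real ?N) ^ card J * \<rho> ^ card V * bexp x (1 / real ?N) J f"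
    by (simp only: bexp_def sum_distrib_left)
  also have "\<dots> \<le> (2 * real ?N) ^ card J * \<rho> ^ card V * \<rho>"
    using insert.prems VW insert.hyps by (intro mult_left_mono insert.prems) auto
  finally show ?case
    using insert.hyps by (simp add: mult_ac)
qed

subsection \<open>Medians and the Chernoff bound over rows\<close>

lemma length_filter_ge:
  assumes "I \<subseteq> {..<length xs}" "\<And>i. i \<in> I \<Longrightarrow> P (xs ! i)"
  shows "card I \<le> length (filter P xs)"
  unfolding length_filter_conv_card using assms by (intro card_mono) auto

lemma length_filter_sort: "length (filter P (sort xs)) = length (filter P xs)"
  by (metis mset_filter mset_sort size_mset)

text \<open>For either parity the median is at most the sorted entry at \<open>m div 2\<close>, so
  that entry and all later ones exceed \<open>e\<close>, which is at least half of the list.\<close>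

lemma median_gt_imp:
  assumes "xs \<noteq> []" "e < median xs"
  shows "length xs \<le> 2 * length (filter (\<lambda>y. e < y) xs)"
proof -
  define ys m where "ys = sort xs" and "m = length xs"
  have m: "length ys = m" "0 < m" "sorted ys"
    using assms by (auto simp: ys_def m_def)
  have mid: "e < ys ! (m div 2)"
  proof (cases "odd m")
    case True
    thus ?thesis using assms(2) m by (simp add: median_def Let_def ys_def m_def)
  next
    case False
    have "ys ! (m div 2 - 1) \<le> ys ! (m div 2)"
      using m by (intro sorted_nth_mono) auto
    thus ?thesis using False assms(2) m by (simp add: median_def Let_def flip: ys_def m_def)
  qed
  have "card {m div 2..<m} \<le> length (filter (\<lambda>y. e < y) ys)"
  proof (rule length_filter_ge)
    fix i assume "i \<in> {m div 2..<m}"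
    hence "ys ! (m div 2) \<le> ys ! i"
      using m by (intro sorted_nth_mono) auto
    thus "e < ys ! i" using mid by simp
  qed (use m in auto)
  thus ?thesis
    by (simp add: ys_def length_filter_sort m_def)
qed

text \<open>The mirror image, with \<open>(m - 1) div 2\<close> as the index of the lower middle
  entry for both parities.\<close>

lemma median_lt_imp:
  assumes "xs \<noteq> []" "median xs < e"
  shows "length xs \<le> 2 * length (filter (\<lambda>y. y < e) xs)"
proof -
  define ys m where "ys = sort xs" and "m = length xs"
  have m: "length ys = m" "0 < m" "sorted ys"
    using assms by (auto simp: ys_def m_def)
  have mid: "ys ! ((m - 1) div 2) < e"
  proof (cases "odd m")
    case True
    hence "(m - 1) div 2 = m div 2" by presburger
    thus ?thesis using True assms(2) m by (simp add: median_def Let_def flip: ys_def m_def)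
  next
    case False
    have "(m - 1) div 2 = m div 2 - 1" using False m by presburger
    moreover have "ys ! (m div 2 - 1) \<le> ys ! (m div 2)"
      using m by (intro sorted_nth_mono) auto
    ultimately show ?thesis using False assms(2) m by (simp add: median_def Let_def flip: ys_def m_def)
  qed
  have "card {..(m - 1) div 2} \<le> length (filter (\<lambda>y. y < e) ys)"
  proof (rule length_filter_ge)
    fix i assume "i \<in> {..(m - 1) div 2}"
    hence "ys ! i \<le> ys ! ((m - 1) div 2)"
      using m by (intro sorted_nth_mono) auto
    thus "ys ! i < e" using mid by simp
  next
    have "(m - 1) div 2 < m" using m by linarith
    thus "{..(m - 1) div 2} \<subseteq> {..<length ys}" using m by auto
  qed
  thus ?thesis
    by (simp add: ys_def length_filter_sort m_def)
qed

text \<open>The error of one row's estimate of coordinate \<open>i\<close>. Since \<open>i\<close>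
  is removed from its own bucket, the sum does not involve \<open>b i\<close>, and the noise is odd
  in that sign.\<close>

definition row_noise :: "nat \<Rightarrow> (nat \<Rightarrow> real) \<Rightarrow> (nat \<Rightarrow> nat) \<Rightarrow> (nat \<Rightarrow> real) \<Rightarrow> nat \<Rightarrow> real" where
  "row_noise n x a b i = b i * (\<Sum>j\<in>{j\<in>{0..<n}. a j = a i} - {i}. b j * x j)"

text \<open>If the median errs by more than \<epsilon>, at least half of the rows err by more than
  \<epsilon> on the same side; \<tau> records that side.\<close>

lemma cs_estimate_dev_imp:
  assumes "i < n" "1 \<le> R" "\<And>u. u < R \<Longrightarrow> s u i \<in> {-1, 1}" "\<epsilon> < \<bar>cs_estimate R n h s x i - x i\<bar>"
  obtains \<tau> :: real where "\<tau> \<in> {-1, 1}"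
    "R \<le> 2 * card {u\<in>{0..<R}. \<epsilon> < \<tau> * row_noise n x (h u) (s u) i}"
proof -
  define g where "g u = s u i * sketch n h s x u (h u i)" for u
  have g: "g u = x i + row_noise n x (h u) (s u) i" if "u < R" for u
  proof -
    have "sketch n h s x u (h u i) = s u i * x i + (\<Sum>j\<in>{j\<in>{0..<n}. h u j = h u i} - {i}. s u j * x j)"
      unfolding sketch_def using assms(1) by (subst sum.remove[of _ i]) auto
    moreover have "s u i * s u i = 1"
      using assms(3)[OF that] by auto
    ultimately show ?thesis
      by (simp add: g_def row_noise_def distrib_left flip: mult.assoc)
  qed
  have est: "cs_estimate R n h s x i = median (map g [0..<R])"
    unfolding cs_estimate_def g_def ..
  have len: "length (filter P (map g [0..<R])) = card {u\<in>{0..<R}. P (g u)}" for P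
    by (auto simp: length_filter_conv_card intro!: arg_cong[where f = card])
  have ne: "map g [0..<R] \<noteq> []" using assms(2) by simp
  consider "x i + \<epsilon> < median (map g [0..<R])" | "median (map g [0..<R]) < x i - \<epsilon>"
    using assms(4) unfolding est by linarith
  thus ?thesis
  proof cases
    case 1
    from median_gt_imp[OF ne this] have "R \<le> 2 * card {u\<in>{0..<R}. x i + \<epsilon> < g u}"
      unfolding len by simp
    also have "{u\<in>{0..<R}. x i + \<epsilon> < g u} = {u\<in>{0..<R}. \<epsilon> < 1 * row_noise n x (h u) (s u) i}"
      using g by auto
    finally show ?thesis by (intro that[of 1]) auto
  next
    case 2
    from median_lt_imp[OF ne this] have "R \<le> 2 * card {u\<in>{0..<R}. g u < x i - \<epsilon>}"
      unfolding len by simp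
    also have "{u\<in>{0..<R}. g u < x i - \<epsilon>} = {u\<in>{0..<R}. \<epsilon> < - 1 * row_noise n x (h u) (s u) i}"
      using g by force
    finally show ?thesis by (intro that[of "- 1"]) auto
  qed
qed

section \<open>Exponential weights and the Chernoff bound over the rows\<close>

definition pen :: "real \<Rightarrow> real \<Rightarrow> real \<Rightarrow> real" where
  "pen \<mu> \<epsilon> y = exp (if \<epsilon> < y then \<mu> else - \<mu>)"

lemma pen_nonneg [simp]: "0 \<le> pen \<mu> \<epsilon> y"
  by (simp add: pen_def)

text \<open>When at least half of the rows exceed \<epsilon>, the exponents \<mu> outweigh the
  exponents -\<mu>. The product of weights therefore dominates the indicator of a deviating
  median.\<close>

lemma prod_pen_ge_1:
  assumes "finite U" "card U \<le> 2 * card {u\<in>U. \<epsilon> < y u}" "0 \<le> \<mu>"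
  shows "1 \<le> (\<Prod>u\<in>U. pen \<mu> \<epsilon> (y u))"
proof -
  have c: "card U = card {u\<in>U. \<epsilon> < y u} + card {u\<in>U. \<not> \<epsilon> < y u}"
    using assms(1) by (subst card_Un_disjoint[symmetric]) (auto intro!: arg_cong[where f = card])
  have "(\<Sum>u\<in>U. if \<epsilon> < y u then \<mu> else - \<mu>) = \<mu> * (real (card {u\<in>U. \<epsilon> < y u}) - real (card {u\<in>U. \<not> \<epsilon> < y u}))"
    using assms(1) by (simp add: sum.If_cases algebra_simps Int_def)
  also have "\<dots> \<ge> 0"
    using assms c by (intro mult_nonneg_nonneg) auto
  finally have "1 \<le> exp (\<Sum>u\<in>U. if \<epsilon> < y u then \<mu> else - \<mu>)"
    by simp
  thus ?thesis
    using assms(1) by (simp add: pen_def exp_sum)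
qed

text \<open>Each coordinate of \<open>M\<close> errs on some side, so the event is covered by 2^|M|
  side patterns \<tau>. For a fixed pattern its indicator is at most a product over coordinates and
  rows of weights, and independence of the rows reduces the bound to the average \<rho> of a single
  row.\<close>

lemma joint_tail_le:
  assumes M: "M \<subseteq> {0..<n}" and "0 \<le> \<mu>" "1 \<le> R" "1 \<le> C" "0 \<le> \<rho>"
    and row: "\<And>\<tau>. \<tau> \<in> M \<rightarrow>\<^sub>E {-1, 1} \<Longrightarrow>
      (\<Sum>a\<in>{0..<n} \<rightarrow>\<^sub>E {0..<C}. \<Sum>b\<in>{0..<n} \<rightarrow>\<^sub>E {-1, 1}. \<Prod>i\<in>M. pen \<mu> \<epsilon> (\<tau> i * row_noise n x a b i))
        \<le> (2 * real C) ^ n * \<rho>"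
  shows "measure_pmf.prob (fully_random R n C)
      {(h, s). \<forall>i\<in>M. \<epsilon> < \<bar>cs_estimate R n h s x i - x i\<bar>} \<le> 2 ^ card M * \<rho> ^ R"
proof -
  define A where "A = {0..<n} \<rightarrow>\<^sub>E {0..<C}"
  define B where "B = {0..<n} \<rightarrow>\<^sub>E {-1, 1 :: real}"
  define E where "E = {(h, s). \<forall>i\<in>M. \<epsilon> < \<bar>cs_estimate R n h s x i - x i\<bar>}"
  let ?H = "{0..<R} \<rightarrow>\<^sub>E A" and ?S = "{0..<R} \<rightarrow>\<^sub>E B"
  let ?\<phi> = "\<lambda>\<tau> a b. \<Prod>i\<in>M. pen \<mu> \<epsilon> (\<tau> i * row_noise n x a b i)"
  have finM: "finite M" using M finite_subset by blast
  have fin: "finite A" "finite B"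
    unfolding A_def B_def by (auto intro!: finite_PiE)
  have cAB: "card A = C ^ n" "card B = 2 ^ n"
    unfolding A_def B_def by (simp_all add: card_funcsetE numeral_2_eq_2)
  have finHS: "finite (?H \<times> ?S)" "?H \<times> ?S \<noteq> {}"
    using fin cAB assms(4) by (auto intro!: finite_PiE simp: PiE_eq_empty_iff)
  have sp: "hash_space R n C = ?H" "sign_space R n = ?S"
    by (simp_all add: hash_space_def sign_space_def A_def B_def)
  have "real (card (?H \<times> ?S \<inter> E)) = (\<Sum>(h, s)\<in>?H \<times> ?S. of_bool ((h, s) \<in> E))"
    using finHS by (simp add: case_prod_unfold Int_def)
  also have "\<dots> \<le> (\<Sum>(h, s)\<in>?H \<times> ?S. \<Sum>\<tau>\<in>M \<rightarrow>\<^sub>E {-1, 1}. \<Prod>u\<in>{0..<R}. ?\<phi> \<tau> (h u) (s u))"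
  proof (rule sum_mono, safe)
    fix h s assume hs: "h \<in> ?H" "s \<in> ?S"
    have nn: "0 \<le> (\<Prod>u\<in>{0..<R}. ?\<phi> \<tau> (h u) (s u))" for \<tau>
      by (intro prod_nonneg ballI) auto
    show "of_bool ((h, s) \<in> E) \<le> (\<Sum>\<tau>\<in>M \<rightarrow>\<^sub>E {-1, 1}. \<Prod>u\<in>{0..<R}. ?\<phi> \<tau> (h u) (s u))"
    proof (cases "(h, s) \<in> E")
      case True
      have "\<exists>\<tau>\<in>{-1, 1}. R \<le> 2 * card {u\<in>{0..<R}. \<epsilon> < \<tau> * row_noise n x (h u) (s u) i}" if "i \<in> M" for i
      proof -
        have i: "i < n" using that M by auto
        have "s u i \<in> {-1, 1}" if "u < R" for u
          using hs(2) that i unfolding B_def by (fastforce simp: PiE_iff)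
        moreover have "\<epsilon> < \<bar>cs_estimate R n h s x i - x i\<bar>"
          using True that by (auto simp: E_def)
        ultimately show ?thesis
          using cs_estimate_dev_imp[OF i assms(3), of s \<epsilon> h x] by blast
      qed
      hence "\<forall>i\<in>M. \<exists>\<tau>. \<tau> \<in> {-1, 1} \<and> R \<le> 2 * card {u\<in>{0..<R}. \<epsilon> < \<tau> * row_noise n x (h u) (s u) i}"
        by blast
      from bchoice[OF this] obtain \<tau> where \<tau>: "\<And>i. i \<in> M \<Longrightarrow> \<tau> i \<in> {-1, 1}"
          "\<And>i. i \<in> M \<Longrightarrow> R \<le> 2 * card {u\<in>{0..<R}. \<epsilon> < \<tau> i * row_noise n x (h u) (s u) i}"
        by blast
      have "1 \<le> (\<Prod>i\<in>M. \<Prod>u\<in>{0..<R}. pen \<mu> \<epsilon> (\<tau> i * row_noise n x (h u) (s u) i))"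
        using \<tau>(2) assms(2) by (intro prod_ge_1 prod_pen_ge_1) simp_all
      also have "\<dots> = (\<Prod>u\<in>{0..<R}. ?\<phi> (restrict \<tau> M) (h u) (s u))"
        by (subst prod.swap) simp
      also have "\<dots> \<le> (\<Sum>\<tau>\<in>M \<rightarrow>\<^sub>E {-1, 1}. \<Prod>u\<in>{0..<R}. ?\<phi> \<tau> (h u) (s u))"
        using \<tau>(1) finM by (intro member_le_sum nn finite_PiE restrict_PiE_iff[THEN iffD2]) auto
      finally show ?thesis using True by simp
    next
      case False
      thus ?thesis using nn by (simp add: sum_nonneg)
    qed
  qed
  also have "\<dots> = (\<Sum>h\<in>?H. \<Sum>s\<in>?S. \<Sum>\<tau>\<in>M \<rightarrow>\<^sub>E {-1, 1}. \<Prod>u\<in>{0..<R}. ?\<phi> \<tau> (h u) (s u))"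
    by (rule sum.cartesian_product[symmetric])
  also have "\<dots> = (\<Sum>h\<in>?H. \<Sum>\<tau>\<in>M \<rightarrow>\<^sub>E {-1, 1}. \<Sum>s\<in>?S. \<Prod>u\<in>{0..<R}. ?\<phi> \<tau> (h u) (s u))"
    by (rule sum.cong[OF refl sum.swap])
  also have "\<dots> = (\<Sum>\<tau>\<in>M \<rightarrow>\<^sub>E {-1, 1}. \<Sum>h\<in>?H. \<Sum>s\<in>?S. \<Prod>u\<in>{0..<R}. ?\<phi> \<tau> (h u) (s u))"
    by (rule sum.swap)
  \<comment> \<open>Independent rows: summing a product over rows gives a product of identical row
    sums, first over the signs and then over the buckets.\<close>
  also have "\<dots> = (\<Sum>\<tau>\<in>M \<rightarrow>\<^sub>E {-1, 1}. (\<Sum>a\<in>A. \<Sum>b\<in>B. ?\<phi> \<tau> a b) ^ R)"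
  proof (rule sum.cong[OF refl])
    fix \<tau> :: "nat \<Rightarrow> real"
    have "(\<Sum>h\<in>?H. \<Sum>s\<in>?S. \<Prod>u\<in>{0..<R}. ?\<phi> \<tau> (h u) (s u)) = (\<Sum>h\<in>?H. \<Prod>u\<in>{0..<R}. \<Sum>b\<in>B. ?\<phi> \<tau> (h u) b)"
      using fin by (intro sum.cong refl, subst prod_sum_PiE) auto
    also have "\<dots> = (\<Prod>u\<in>{0..<R}. \<Sum>a\<in>A. \<Sum>b\<in>B. ?\<phi> \<tau> a b)"
      using fin by (subst prod_sum_PiE) auto
    finally show "(\<Sum>h\<in>?H. \<Sum>s\<in>?S. \<Prod>u\<in>{0..<R}. ?\<phi> \<tau> (h u) (s u)) = (\<Sum>a\<in>A. \<Sum>b\<in>B. ?\<phi> \<tau> a b) ^ R"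
      by simp
  qed
  also have "\<dots> \<le> (\<Sum>\<tau>\<in>M \<rightarrow>\<^sub>E {-1, 1 :: real}. ((2 * real C) ^ n * \<rho>) ^ R)"
    using row unfolding A_def B_def by (intro sum_mono power_mono sum_nonneg prod_nonneg) auto
  also have "\<dots> = 2 ^ card M * \<rho> ^ R * real (card (?H \<times> ?S))"
    using finM by (simp add: card_funcsetE cAB card_cartesian_product numeral_2_eq_2 power_mult_distrib)
  finally have "real (card (?H \<times> ?S \<inter> E)) \<le> 2 ^ card M * \<rho> ^ R * real (card (?H \<times> ?S))" .
  moreover have "0 < card (?H \<times> ?S)"
    using finHS card_gt_0_iff by blast
  ultimately show ?thesis
    unfolding fully_random_def sp measure_pmf_of_set[OF finHS(2,1)] E_def[symmetric]
    by (simp add: pos_divide_le_eq)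
qed

subsection \<open>One row\<close>

lemma exp_le_taylor2:
  fixes x y :: real
  assumes "\<bar>x\<bar> \<le> y"
  shows "exp x \<le> 1 + x + x\<^sup>2 / 2 * exp y"
proof -
  obtain t where t: "\<bar>t\<bar> \<le> \<bar>x\<bar>" "exp x = (\<Sum>m<2. (x ^ m) / fact m) + (exp t / fact 2) * x ^ 2"
    using Maclaurin_exp_le[of x 2] by blast
  have "exp t * x\<^sup>2 \<le> exp y * x\<^sup>2"
    using t(1) assms by (intro mult_right_mono) auto
  thus ?thesis
    using t(2) by (simp add: numeral_2_eq_2 mult_ac)
qed

text \<open>Averaging over the sign of the noise leaves only whether it is small: outside
  [-\<epsilon>, \<epsilon>] exactly one of y, -y is penalised, giving cosh \<mu>, and inside neither
  is, giving exp(-\<mu>) = cosh \<mu> - sinh \<mu>.\<close>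

lemma pen_add_pen_minus:
  assumes "0 \<le> \<epsilon>" "0 \<le> \<mu>"
  shows "pen \<mu> \<epsilon> y + pen \<mu> \<epsilon> (- y) = 2 * (cosh \<mu> - sinh \<mu> * of_bool (\<bar>y\<bar> \<le> \<epsilon>))"
  using assms by (auto simp: pen_def cosh_def sinh_def field_simps)

text \<open>When \<open>M\<close> occupies distinct buckets, the noise of its members comes from
  coordinates outside \<open>M\<close> only. The signs on \<open>M\<close> are then free, and
  averaging over them turns every weight into 2 f of a bucket content, to which
  \<open>buckets_product_le\<close> applies. At most |M| - 1 buckets are removed before the last is
  revealed, hence the range of \<open>C'\<close>.\<close>

lemma sum_noncollision_le:
  assumes M: "M \<subseteq> {0..<n}" and "1 \<le> C" "0 \<le> \<epsilon>" "0 \<le> \<mu>" and \<tau>: "\<tau> \<in> M \<rightarrow>\<^sub>E {-1, 1 :: real}"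
    and "0 \<le> p" "p \<le> 1"
    and p: "\<And>I C'. I \<subseteq> {0..<n} \<Longrightarrow> C - card M < C' \<Longrightarrow> C' \<le> C \<Longrightarrow>
          p \<le> bexp x (1 / real C') I (\<lambda>y. of_bool (\<bar>y\<bar> \<le> \<epsilon>))"
  shows "(\<Sum>a\<in>{a\<in>{0..<n} \<rightarrow>\<^sub>E {0..<C}. inj_on a M}. \<Sum>b\<in>{0..<n} \<rightarrow>\<^sub>E {-1, 1}.
            \<Prod>i\<in>M. pen \<mu> \<epsilon> (\<tau> i * row_noise n x a b i))
    \<le> real (card {a\<in>{0..<n} \<rightarrow>\<^sub>E {0..<C}. inj_on a M}) * 2 ^ n * (cosh \<mu> - p * sinh \<mu>) ^ card M"
proof -
  define J where "J = {0..<n} - M"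
  define \<rho> where "\<rho> = cosh \<mu> - p * sinh \<mu>"
  define f where "f = (\<lambda>y. cosh \<mu> - sinh \<mu> * of_bool (\<bar>y\<bar> \<le> \<epsilon>))"
  let ?W = "{0..<C}"
  have n: "{0..<n} = M \<union> J" "M \<inter> J = {}" using M by (auto simp: J_def)
  have fin: "finite M" "finite J" using M finite_subset by (auto simp: J_def)
  have nc: "n = card M + card J"
    using card_Un_disjoint[OF fin n(2)] n(1) by (metis card_atLeastLessThan diff_zero)
  have sc: "0 \<le> sinh \<mu>" "sinh \<mu> \<le> cosh \<mu>"
    using assms by (auto simp: sinh_real_nonneg_iff sinh_le_cosh_real)
  have f0: "0 \<le> f y" for y
    using sc by (auto simp: f_def)
  have "p * sinh \<mu> \<le> 1 * sinh \<mu>"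
    using assms sc by (intro mult_right_mono) auto
  hence \<rho>0: "0 \<le> \<rho>" using sc by (simp add: \<rho>_def)
  have fb: "bexp x (1 / real C') I f \<le> \<rho>"
    if "I \<subseteq> J" "C - card M < C'" "C' \<le> C" for I C'
  proof -
    have "finite I" using that fin finite_subset by auto
    have "bexp x (1 / real C') I (\<lambda>y. cosh \<mu> + (- sinh \<mu>) * of_bool (\<bar>y\<bar> \<le> \<epsilon>)) =
      cosh \<mu> - sinh \<mu> * bexp x (1 / real C') I (\<lambda>y. of_bool (\<bar>y\<bar> \<le> \<epsilon>))"
      unfolding bexp_add bexp_cmult bexp_const[OF \<open>finite I\<close>] by simp
    moreover have "sinh \<mu> * p \<le> sinh \<mu> * bexp x (1 / real C') I (\<lambda>y. of_bool (\<bar>y\<bar> \<le> \<epsilon>))"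
      using that n sc by (intro mult_left_mono p) auto
    ultimately show ?thesis
      by (simp add: f_def \<rho>_def mult.commute)
  qed
  have inner: "(\<Sum>a\<in>J \<rightarrow>\<^sub>E ?W. \<Sum>b\<in>(M \<union> J) \<rightarrow>\<^sub>E {-1, 1}.
      \<Prod>i\<in>M. pen \<mu> \<epsilon> (\<tau> i * row_noise n x (\<lambda>j. if j \<in> M then \<alpha> j else a j) b i))
      \<le> 2 ^ card M * ((2 * real C) ^ card J * \<rho> ^ card M)"
    if \<alpha>: "\<alpha> \<in> M \<rightarrow>\<^sub>E ?W" "inj_on \<alpha> M" for \<alpha>
  proof -
    define Y where "Y a b v = (\<Sum>j\<in>{j\<in>J. a j = v}. b j * x j)" for a :: "nat \<Rightarrow> nat" and b v
    \<comment> \<open>Injectivity of \<alpha> on \<open>M\<close> leaves no other member of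
      \<open>M\<close> in the bucket of \<open>i\<close>, so the noise is its sign times the content
      contributed by \<open>J\<close>.\<close>
    have noise: "row_noise n x (\<lambda>j. if j \<in> M then \<alpha> j else a j) (\<lambda>j. if j \<in> M then \<beta> j else b j) i
        = \<beta> i * Y a b (\<alpha> i)" if "i \<in> M" for a b \<beta> i
    proof -
      have "{j\<in>{0..<n}. (if j \<in> M then \<alpha> j else a j) = (if i \<in> M then \<alpha> i else a i)} - {i} = {j\<in>J. a j = \<alpha> i}"
        using that \<alpha>(2) n by (auto simp: inj_on_def split: if_splits)
      thus ?thesis
        using that n(2) unfolding row_noise_def Y_def
        by (auto intro!: sum.cong arg_cong[where f = "\<lambda>z. \<beta> i * z"])
    qed
    have "(\<Sum>b\<in>(M \<union> J) \<rightarrow>\<^sub>E {-1, 1}. \<Prod>i\<in>M. pen \<mu> \<epsilon> (\<tau> i * row_noise n x (\<lambda>j. if j \<in> M then \<alpha> j else a j) b i))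
      = (\<Sum>b\<in>J \<rightarrow>\<^sub>E {-1, 1}. 2 ^ card M * (\<Prod>v\<in>\<alpha> ` M. f (Y a b v)))" for a
    proof -
      have "(\<Sum>b\<in>(M \<union> J) \<rightarrow>\<^sub>E {-1, 1}. \<Prod>i\<in>M. pen \<mu> \<epsilon> (\<tau> i * row_noise n x (\<lambda>j. if j \<in> M then \<alpha> j else a j) b i))
        = (\<Sum>b\<in>J \<rightarrow>\<^sub>E {-1, 1}. \<Sum>\<beta>\<in>M \<rightarrow>\<^sub>E {-1, 1}. \<Prod>i\<in>M. pen \<mu> \<epsilon> (\<tau> i * (\<beta> i * Y a b (\<alpha> i))))"
        by (subst sum_PiE_Un[OF n(2)], subst sum.swap) (simp add: noise cong: prod.cong)
      also have "\<dots> = (\<Sum>b\<in>J \<rightarrow>\<^sub>E {-1, 1}. \<Prod>i\<in>M. \<Sum>\<beta>\<in>{-1, 1}. pen \<mu> \<epsilon> (\<tau> i * (\<beta> * Y a b (\<alpha> i))))"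
        using fin by (intro sum.cong refl, subst prod_sum_PiE) auto
      also have "\<dots> = (\<Sum>b\<in>J \<rightarrow>\<^sub>E {-1, 1}. \<Prod>i\<in>M. 2 * f (Y a b (\<alpha> i)))"
      proof (intro sum.cong prod.cong refl)
        fix i b assume "i \<in> M"
        hence "\<tau> i = 1 \<or> \<tau> i = -1" using \<tau> by (auto simp: PiE_iff)
        thus "(\<Sum>\<beta>\<in>{-1, 1}. pen \<mu> \<epsilon> (\<tau> i * (\<beta> * Y a b (\<alpha> i)))) = 2 * f (Y a b (\<alpha> i))"
          using pen_add_pen_minus[OF assms(3,4), of "Y a b (\<alpha> i)"] by (auto simp: f_def add.commute)
      qed
      also have "\<dots> = (\<Sum>b\<in>J \<rightarrow>\<^sub>E {-1, 1}. 2 ^ card M * (\<Prod>v\<in>\<alpha> ` M. f (Y a b v)))"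
        by (simp add: prod.distrib prod.reindex[OF \<alpha>(2)])
      finally show ?thesis .
    qed
    hence "(\<Sum>a\<in>J \<rightarrow>\<^sub>E ?W. \<Sum>b\<in>(M \<union> J) \<rightarrow>\<^sub>E {-1, 1}.
        \<Prod>i\<in>M. pen \<mu> \<epsilon> (\<tau> i * row_noise n x (\<lambda>j. if j \<in> M then \<alpha> j else a j) b i))
      = 2 ^ card M * (\<Sum>a\<in>J \<rightarrow>\<^sub>E ?W. \<Sum>b\<in>J \<rightarrow>\<^sub>E {-1, 1}. \<Prod>v\<in>\<alpha> ` M. f (Y a b v))"
      by (simp add: sum_distrib_left)
    also have "(\<Sum>a\<in>J \<rightarrow>\<^sub>E ?W. \<Sum>b\<in>J \<rightarrow>\<^sub>E {-1, 1}. \<Prod>v\<in>\<alpha> ` M. f (Y a b v))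
      \<le> (2 * real (card ?W)) ^ card J * \<rho> ^ card (\<alpha> ` M)"
      unfolding Y_def
      by (rule buckets_product_le) (use \<alpha> fin f0 \<rho>0 fb in \<open>auto simp: card_image\<close>)
    finally show ?thesis
      using \<alpha> by (simp add: card_image)
  qed
  define K where "K = {\<alpha>\<in>M \<rightarrow>\<^sub>E ?W. inj_on \<alpha> M}"
  have finA: "finite ((M \<union> J) \<rightarrow>\<^sub>E ?W)" "finite (M \<rightarrow>\<^sub>E ?W)" "finite (J \<rightarrow>\<^sub>E ?W)"
    using fin by (auto intro!: finite_PiE)
  have split: "(\<Sum>a\<in>{a\<in>(M \<union> J) \<rightarrow>\<^sub>E ?W. inj_on a M}. F a) =
      (\<Sum>\<alpha>\<in>K. \<Sum>a\<in>J \<rightarrow>\<^sub>E ?W. F (\<lambda>j. if j \<in> M then \<alpha> j else a j))" for F :: "(nat \<Rightarrow> nat) \<Rightarrow> real"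
  proof -
    have "(\<Sum>a\<in>{a\<in>(M \<union> J) \<rightarrow>\<^sub>E ?W. inj_on a M}. F a) = (\<Sum>a\<in>(M \<union> J) \<rightarrow>\<^sub>E ?W. if inj_on a M then F a else 0)"
      using finA by (simp add: sum.inter_filter)
    also have "\<dots> = (\<Sum>\<alpha>\<in>M \<rightarrow>\<^sub>E ?W. if inj_on \<alpha> M then (\<Sum>a\<in>J \<rightarrow>\<^sub>E ?W. F (\<lambda>j. if j \<in> M then \<alpha> j else a j)) else 0)"
    proof (subst sum_PiE_Un[OF n(2)], rule sum.cong[OF refl])
      fix \<alpha> :: "nat \<Rightarrow> nat"
      have "inj_on (\<lambda>j. if j \<in> M then \<alpha> j else a j) M = inj_on \<alpha> M" for a :: "nat \<Rightarrow> nat"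
        by (rule inj_on_cong) simp
      thus "(\<Sum>a\<in>J \<rightarrow>\<^sub>E ?W. if inj_on (\<lambda>j. if j \<in> M then \<alpha> j else a j) M
            then F (\<lambda>j. if j \<in> M then \<alpha> j else a j) else 0) =
          (if inj_on \<alpha> M then \<Sum>a\<in>J \<rightarrow>\<^sub>E ?W. F (\<lambda>j. if j \<in> M then \<alpha> j else a j) else 0)"
        by simp
    qed
    finally show ?thesis
      using finA by (simp add: sum.inter_filter K_def)
  qed
  have cK: "real (card {a\<in>(M \<union> J) \<rightarrow>\<^sub>E ?W. inj_on a M}) = real (card K) * real C ^ card J"
    using split[of "\<lambda>_. 1"] fin by (simp add: card_funcsetE)
  have "(\<Sum>a\<in>{a\<in>(M \<union> J) \<rightarrow>\<^sub>E ?W. inj_on a M}. \<Sum>b\<in>(M \<union> J) \<rightarrow>\<^sub>E {-1, 1}.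
            \<Prod>i\<in>M. pen \<mu> \<epsilon> (\<tau> i * row_noise n x a b i))
      \<le> (\<Sum>\<alpha>\<in>K. 2 ^ card M * ((2 * real C) ^ card J * \<rho> ^ card M))"
    unfolding split by (intro sum_mono inner) (auto simp: K_def)
  also have "\<dots> = real (card K) * real C ^ card J * 2 ^ n * \<rho> ^ card M"
    by (simp add: nc power_add power_mult_distrib)
  finally show ?thesis
    unfolding cK[folded n(1)] n(1)[symmetric] \<rho>_def .
qed

lemma row_noise_flip:
  assumes "i < n"
  shows "row_noise n x a (b(i := - b i)) i = - row_noise n x a b i"
proof -
  have "(\<Sum>j\<in>{j\<in>{0..<n}. a j = a i} - {i}. (b(i := - b i)) j * x j) = (\<Sum>j\<in>{j\<in>{0..<n}. a j = a i} - {i}. b j * x j)"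
    by (intro sum.cong) auto
  thus ?thesis by (simp add: row_noise_def)
qed

text \<open>Without any independence the first-order term is still nonpositive, by symmetry of the noise.\<close>

lemma sum_collision_le:
  assumes M: "M \<subseteq> {0..<n}" and "0 \<le> \<epsilon>" "0 \<le> \<mu>" and "\<And>i. i \<in> M \<Longrightarrow> \<tau> i \<in> {-1, 1 :: real}"
  defines "y \<equiv> real (card M) * \<mu>"
  shows "(\<Sum>b\<in>{0..<n} \<rightarrow>\<^sub>E {-1, 1}. \<Prod>i\<in>M. pen \<mu> \<epsilon> (\<tau> i * row_noise n x a b i)) \<le> 2 ^ n * (1 + y\<^sup>2 * exp y)"
proof -
  let ?B = "{0..<n} \<rightarrow>\<^sub>E {-1, 1 :: real}"
  define g where "g i b = (if \<epsilon> < \<tau> i * row_noise n x a b i then \<mu> else - \<mu>)" for i b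
  have finM: "finite M" using M finite_subset by blast
  have cB: "real (card ?B) = 2 ^ n" by (simp add: card_funcsetE numeral_2_eq_2)
  have g_abs: "\<bar>\<Sum>i\<in>M. g i b\<bar> \<le> y" for b
  proof -
    have "\<bar>\<Sum>i\<in>M. g i b\<bar> \<le> (\<Sum>i\<in>M. \<bar>g i b\<bar>)" by (rule sum_abs)
    also have "\<dots> \<le> (\<Sum>i\<in>M. \<mu>)" using assms(3) by (intro sum_mono) (auto simp: g_def)
    finally show ?thesis by (simp add: y_def)
  qed
  have g_sum: "(\<Sum>b\<in>?B. g i b) \<le> 0" if "i \<in> M" for i
  proof -
    have i: "i < n" using that M by auto
    \<comment> \<open>Flipping the sign of \<open>i\<close> is an involution that negates the noise.
      As \<epsilon> \<ge> 0, at most one of the two values exceeds \<epsilon>, so the paired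
      exponents add up to at most 0.\<close>
    have "(\<Sum>b\<in>?B. g i b) = (\<Sum>b\<in>?B. g i (b(i := - b i)))"
      by (rule sum.reindex_bij_witness[where i = "\<lambda>b. b(i := - b i)" and j = "\<lambda>b. b(i := - b i)"])
         (use i in \<open>auto simp: PiE_iff extensional_def split: if_splits\<close>)
    hence "2 * (\<Sum>b\<in>?B. g i b) = (\<Sum>b\<in>?B. g i b + g i (b(i := - b i)))"
      by (simp add: sum.distrib)
    also have "\<dots> \<le> (\<Sum>b\<in>?B. 0)"
      using assms(2,3) by (intro sum_mono) (auto simp: g_def row_noise_flip[OF i])
    finally show ?thesis by simp
  qed
  have "(\<Sum>b\<in>?B. \<Prod>i\<in>M. pen \<mu> \<epsilon> (\<tau> i * row_noise n x a b i)) = (\<Sum>b\<in>?B. exp (\<Sum>i\<in>M. g i b))"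
    using finM by (simp add: exp_sum g_def pen_def)
  \<comment> \<open>Second-order Taylor bound for the total exponent, whose linear part has
    nonpositive sum by the symmetry above.\<close>
  also have "\<dots> \<le> (\<Sum>b\<in>?B. 1 + (\<Sum>i\<in>M. g i b) + y\<^sup>2 * exp y)"
  proof (rule sum_mono)
    fix b
    have "(\<Sum>i\<in>M. g i b)\<^sup>2 \<le> y\<^sup>2"
      using g_abs[of b] by (simp add: abs_le_square_iff[symmetric])
    hence "(\<Sum>i\<in>M. g i b)\<^sup>2 / 2 \<le> y\<^sup>2"
      using zero_le_power2[of y] by linarith
    hence "(\<Sum>i\<in>M. g i b)\<^sup>2 / 2 * exp y \<le> y\<^sup>2 * exp y"
      by (intro mult_right_mono) auto
    thus "exp (\<Sum>i\<in>M. g i b) \<le> 1 + (\<Sum>i\<in>M. g i b) + y\<^sup>2 * exp y"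
      using exp_le_taylor2[OF g_abs[of b]] by linarith
  qed
  also have "\<dots> = (\<Sum>i\<in>M. \<Sum>b\<in>?B. g i b) + 2 ^ n * (1 + y\<^sup>2 * exp y)"
    using sum.swap[of g ?B M] by (simp add: sum.distrib cB[simplified] algebra_simps)
  also have "\<dots> \<le> 2 ^ n * (1 + y\<^sup>2 * exp y)"
    using g_sum by (simp add: sum_nonpos)
  finally show ?thesis .
qed

text \<open>A union bound over pairs. Each pair collides in at most a 1/C fraction of the
  assignments, because overwriting \<open>a i\<close> by any of the C values is injective on
  colliding assignments: the old value can be read off at \<open>j\<close>.\<close>

lemma card_collision_le:
  assumes M: "M \<subseteq> {0..<n}"
  shows "card {a\<in>{0..<n} \<rightarrow>\<^sub>E {0..<C}. \<not> inj_on a M} * C \<le> (card M)\<^sup>2 * C ^ n"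
proof -
  let ?A = "{0..<n} \<rightarrow>\<^sub>E {0..<C}"
  have finA: "finite ?A" by (auto intro!: finite_PiE)
  have finM: "finite M" using M finite_subset by blast
  have pair: "card {a\<in>?A. i \<noteq> j \<and> a i = a j} * C \<le> C ^ n" if "i \<in> M" "j \<in> M" for i j
  proof -
    have ij: "i < n" "j < n" using that M by auto
    have "card ({a\<in>?A. i \<noteq> j \<and> a i = a j} \<times> {0..<C}) \<le> card ?A"
    proof (rule card_inj_on_le)
      show "inj_on (\<lambda>(a, v). a(i := v)) ({a\<in>?A. i \<noteq> j \<and> a i = a j} \<times> {0..<C})"
      proof (rule inj_onI, clarify)
        fix a b :: "nat \<Rightarrow> nat" and v w assume *: "i \<noteq> j" "a i = a j" "b i = b j" "a(i := v) = b(i := w)"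
        have off: "a k = b k" if "k \<noteq> i" for k
          using fun_cong[OF *(4), of k] that by simp
        have "a k = b k" for k
          using off[of k] off[of j] *(1-3) by (cases "k = i") auto
        thus "a = b \<and> v = w" using fun_cong[OF *(4), of i] by auto
      qed
    qed (use ij finA in \<open>auto simp: PiE_iff extensional_def\<close>)
    thus ?thesis by (simp add: card_cartesian_product card_funcsetE)
  qed
  have "card {a\<in>?A. \<not> inj_on a M} \<le> card (\<Union>(i, j)\<in>M \<times> M. {a\<in>?A. i \<noteq> j \<and> a i = a j})"
    using finA finM by (intro card_mono) (auto simp: inj_on_def)
  also have "\<dots> \<le> (\<Sum>(i, j)\<in>M \<times> M. card {a\<in>?A. i \<noteq> j \<and> a i = a j})"
    using card_UN_le[of "M \<times> M" "\<lambda>(i, j). {a\<in>?A. i \<noteq> j \<and> a i = a j}"] finM by (simp add: case_prod_unfold)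
  finally have "card {a\<in>?A. \<not> inj_on a M} * C \<le> (\<Sum>(i, j)\<in>M \<times> M. card {a\<in>?A. i \<noteq> j \<and> a i = a j} * C)"
    by (simp add: case_prod_unfold flip: sum_distrib_right)
  also have "\<dots> \<le> (\<Sum>(i, j)\<in>M \<times> M. C ^ n)"
    using pair by (intro sum_mono) auto
  finally show ?thesis
    by (simp add: case_prod_unfold card_cartesian_product power2_eq_square)
qed

text \<open>Here P is the collision probability of a row. With a = m \<kappa> p^2 / 4, rows without
  collision contribute exp(-2a), and y^2 = 4 a m \<kappa>, so the excess of colliding rows is itself
  proportional to a. Small P thus absorbs it however small a is, at the cost of half the
  exponent.\<close>

lemma row_mixture_le:
  fixes m :: nat and \<kappa> p P :: real
  assumes "0 \<le> p" "p \<le> 1" "0 \<le> \<kappa>" "\<kappa> \<le> 1 / 4" "1 \<le> m" "0 \<le> P"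
    and P: "P * (4 * real m * exp (2 * real m * \<kappa>)) \<le> 1"
  defines "y \<equiv> real m * (\<kappa> * p)"
  shows "(1 - P) * exp (- (real m * \<kappa> * p\<^sup>2 / 2)) + P * (1 + y\<^sup>2 * exp y) \<le> exp (- (real m * \<kappa> * p\<^sup>2 / 4))"
proof -
  define a where "a = real m * \<kappa> * p\<^sup>2 / 4"
  have a0: "0 \<le> a" using assms by (simp add: a_def)
  have y2: "y\<^sup>2 = 4 * a * (real m * \<kappa>)"
    by (simp add: y_def a_def power2_eq_square)
  have "\<kappa> * p \<le> \<kappa>" using assms by (simp add: mult_left_le)
  hence y: "0 \<le> y" "y \<le> real m * \<kappa>"
    using assms by (auto simp: y_def intro: mult_left_mono)
  have e1: "1 \<le> exp y" using y by simp
  have "p\<^sup>2 \<le> 1" using assms by (simp add: power_le_one)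
  hence "real m * \<kappa> * p\<^sup>2 \<le> real m * \<kappa>" using assms by (intro mult_left_le) auto
  moreover have "0 \<le> real m * \<kappa>" using assms by simp
  ultimately have a2: "2 * a \<le> real m * \<kappa>" unfolding a_def by linarith
  have "1 - exp (- (2 * a)) \<le> 2 * a"
    using exp_ge_add_one_self[of "- (2 * a)"] by simp
  moreover have "2 * a + y\<^sup>2 * exp y \<le> 4 * a * real m * exp (real m * \<kappa>)"
  proof -
    have "2 * a * 1 \<le> 2 * a * (real m * exp y)"
      using a0 assms(5) e1 by (intro mult_left_mono) (auto intro: order_trans[OF _ mult_mono[of 1 "real m" 1 "exp y"]])
    moreover have "4 * a * (real m * \<kappa>) * exp y \<le> 4 * a * (real m * (1 / 4)) * exp y"
      using a0 assms by (intro mult_right_mono mult_left_mono) auto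
    moreover have "0 \<le> a * (real m * exp y)" using a0 by simp
    ultimately have "2 * a + y\<^sup>2 * exp y \<le> 4 * a * real m * exp y"
      unfolding y2 by (simp add: algebra_simps)
    also have "\<dots> \<le> 4 * a * real m * exp (real m * \<kappa>)"
      using y a0 by (intro mult_left_mono) auto
    finally show ?thesis .
  qed
  ultimately have "P * (1 - exp (- (2 * a)) + y\<^sup>2 * exp y) \<le> P * (4 * a * real m * exp (real m * \<kappa>))"
    using assms(6) by (intro mult_left_mono) auto
  \<comment> \<open>One of the two factors exp(m \<kappa>) in the hypothesis on P pays for exp y,
    the other provides exp(-m \<kappa>) \<le> exp(-2a).\<close>
  also have "\<dots> = a * exp (- (real m * \<kappa>)) * (P * (4 * real m * exp (2 * real m * \<kappa>)))"
  proof -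
    have "exp (2 * real m * \<kappa>) = exp (real m * \<kappa>) * exp (real m * \<kappa>)"
      by (simp flip: exp_add)
    thus ?thesis by (simp add: exp_minus field_simps)
  qed
  also have "\<dots> \<le> a * exp (- (real m * \<kappa>)) * 1"
    using a0 P by (intro mult_left_mono) auto
  also have "\<dots> \<le> a * exp (- (2 * a))"
    using a0 a2 by (simp add: mult_left_mono)
  finally have "(1 - P) * exp (- (2 * a)) + P * (1 + y\<^sup>2 * exp y) \<le> (1 + a) * exp (- (2 * a))"
    by (simp add: algebra_simps)
  also have "\<dots> \<le> exp a * exp (- (2 * a))"
    by (intro mult_right_mono) auto
  also have "\<dots> = exp (- a)"
    by (simp flip: exp_add)
  finally have "(1 - P) * exp (- (2 * a)) + P * (1 + y\<^sup>2 * exp y) \<le> exp (- a)" .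
  moreover have "real m * \<kappa> * p\<^sup>2 / 2 = 2 * a" by (simp add: a_def)
  ultimately show ?thesis
    by (simp only: a_def[symmetric])
qed

text \<open>With Chernoff parameter \<mu> = \<kappa> p, the first-order gain is p \<mu> = \<kappa>
  p^2, while the losses are of order \<mu>^2 \<le> \<kappa> p^2 / 4 and leave at least half of the
  gain.\<close>

lemma cosh_minus_sinh_le:
  fixes \<kappa> p :: real
  assumes "0 \<le> p" "p \<le> 1" "0 \<le> \<kappa>" "\<kappa> \<le> 1 / 4"
  shows "cosh (\<kappa> * p) - p * sinh (\<kappa> * p) \<le> exp (- (\<kappa> * p\<^sup>2 / 2))"
proof -
  define \<mu> where "\<mu> = \<kappa> * p"
  have "\<kappa> * p \<le> \<kappa>" using assms by (simp add: mult_left_le)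
  hence \<mu>: "0 \<le> \<mu>" "\<mu> \<le> 1 / 4" "\<mu> \<le> \<kappa>" using assms by (auto simp: \<mu>_def)
  have e: "exp (1 / 4 :: real) \<le> 2"
    using exp_bound_half[of "1 / 4 :: real"] by simp
  have *: "exp z \<le> 1 + z + \<mu>\<^sup>2" if "z = \<mu> \<or> z = - \<mu>" for z
  proof -
    have "\<mu>\<^sup>2 * exp (1 / 4) \<le> \<mu>\<^sup>2 * 2" using e by (intro mult_left_mono) auto
    thus ?thesis
      using exp_le_taylor2[of z "1 / 4"] \<mu> that by auto
  qed
  have c: "cosh \<mu> \<le> 1 + \<mu>\<^sup>2"
    using *[of \<mu>] *[of "- \<mu>"] by (simp add: cosh_def)
  have "\<mu> - \<mu>\<^sup>2 / 2 \<le> sinh \<mu>"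
  proof -
    have "sinh \<mu> = (exp \<mu> - exp (- \<mu>)) / 2" by (simp add: sinh_def)
    thus ?thesis using exp_ge_add_one_self[of \<mu>] *[of "- \<mu>", OF disjI2[OF refl]] by (simp only:) argo
  qed
  hence s: "p * (\<mu> - \<mu>\<^sup>2 / 2) \<le> p * sinh \<mu>"
    using assms by (intro mult_left_mono) auto
  have "p * \<mu>\<^sup>2 \<le> \<mu>\<^sup>2" using assms by (intro mult_left_le_one_le) auto
  moreover have "\<mu>\<^sup>2 \<le> \<kappa> * p\<^sup>2 / 4"
  proof -
    have "\<mu>\<^sup>2 = (\<kappa> * p\<^sup>2) * \<kappa>" by (simp add: \<mu>_def power2_eq_square)
    also have "\<dots> \<le> (\<kappa> * p\<^sup>2) * (1 / 4)" using assms by (intro mult_left_mono) auto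
    finally show ?thesis by simp
  qed
  moreover have "p * \<mu> = \<kappa> * p\<^sup>2" by (simp add: \<mu>_def power2_eq_square)
  moreover have "0 \<le> \<kappa> * p\<^sup>2" using assms by simp
  ultimately have "cosh \<mu> - p * sinh \<mu> \<le> 1 + - (\<kappa> * p\<^sup>2 / 2)"
    using c s by (simp add: right_diff_distrib)
  also have "\<dots> \<le> exp (- (\<kappa> * p\<^sup>2 / 2))"
    by (rule exp_ge_add_one_self)
  finally show ?thesis by (simp add: \<mu>_def)
qed

text \<open>Combines the bounds for rows with and without collision. The collision probability is at
  most m^2/C for m = |M|, so the lower bound on C is exactly what \<open>row_mixture_le\<close> asks
  for.\<close>

lemma joint_tail_exp_le:
  assumes M: "M \<subseteq> {0..<n}" "M \<noteq> {}" and "1 \<le> R" "0 \<le> \<epsilon>" "0 \<le> p" "p \<le> 1" "0 \<le> \<kappa>" "\<kappa> \<le> 1 / 4"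
    and C: "4 * real (card M) ^ 3 * exp (2 * real (card M) * \<kappa>) \<le> real C"
    and p: "\<And>I C'. I \<subseteq> {0..<n} \<Longrightarrow> C - card M < C' \<Longrightarrow> C' \<le> C \<Longrightarrow>
          p \<le> bexp x (1 / real C') I (\<lambda>y. of_bool (\<bar>y\<bar> \<le> \<epsilon>))"
  shows "measure_pmf.prob (fully_random R n C)
      {(h, s). \<forall>i\<in>M. \<epsilon> < \<bar>cs_estimate R n h s x i - x i\<bar>} \<le> (2 * exp (- (\<kappa> * p\<^sup>2 * real R / 4))) ^ card M"
proof -
  define m where "m = card M"
  define \<mu> where "\<mu> = \<kappa> * p"
  have finM: "finite M" using M finite_subset by blast
  hence m: "1 \<le> m" using M(2) by (auto simp: m_def Suc_le_eq card_gt_0_iff)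
  have "0 < 4 * real m ^ 3 * exp (2 * real m * \<kappa>)"
    using m by simp
  hence C0: "0 < real C" using C unfolding m_def by linarith
  have \<mu>: "0 \<le> \<mu>" using assms by (simp add: \<mu>_def)
  define a where "a = real m * \<kappa> * p\<^sup>2 / 4"
  have "measure_pmf.prob (fully_random R n C)
      {(h, s). \<forall>i\<in>M. \<epsilon> < \<bar>cs_estimate R n h s x i - x i\<bar>} \<le> 2 ^ card M * exp (- a) ^ R"
  proof (rule joint_tail_le[OF M(1) \<mu>])
    fix \<tau> :: "nat \<Rightarrow> real" assume \<tau>: "\<tau> \<in> M \<rightarrow>\<^sub>E {-1, 1}"
    let ?A = "{0..<n} \<rightarrow>\<^sub>E {0..<C}"
    let ?I = "{a\<in>?A. inj_on a M}" and ?N = "{a\<in>?A. \<not> inj_on a M}"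
    let ?F = "\<lambda>a. \<Sum>b\<in>{0..<n} \<rightarrow>\<^sub>E {-1, 1}. \<Prod>i\<in>M. pen \<mu> \<epsilon> (\<tau> i * row_noise n x a b i)"
    define y where "y = real m * (\<kappa> * p)"
    define P where "P = real (card ?N) / real C ^ n"
    have finA: "finite ?A" by (auto intro!: finite_PiE)
    have "?I \<union> ?N = ?A" by auto
    hence "card ?A = card ?I + card ?N"
      using card_Un_disjoint[of ?I ?N] finA by fastforce
    hence cA: "real (card ?I) = real C ^ n * (1 - P)"
      using C0 by (simp add: P_def card_funcsetE field_simps flip: of_nat_power of_nat_add)
    have cN: "real (card ?N) = real C ^ n * P"
      using C0 by (simp add: P_def)
    have P0: "0 \<le> P" by (simp add: P_def)
    have "real (card ?N * C) \<le> real ((card M)\<^sup>2 * C ^ n)"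
      using card_collision_le[OF M(1), of C] by (rule of_nat_mono)
    hence PC: "P * real C \<le> real m ^ 2"
      using C0 by (simp add: P_def m_def field_simps)
    have Pm: "P * (4 * real m * exp (2 * real m * \<kappa>)) \<le> 1"
    proof -
      have "(P * real C) * (4 * real m * exp (2 * real m * \<kappa>)) \<le> real m ^ 2 * (4 * real m * exp (2 * real m * \<kappa>))"
        using PC by (intro mult_right_mono) auto
      also have "\<dots> = 4 * real m ^ 3 * exp (2 * real m * \<kappa>)"
        by (simp add: power2_eq_square power3_eq_cube)
      also have "\<dots> \<le> real C" using C by (simp add: m_def)
      finally have "real C * (P * (4 * real m * exp (2 * real m * \<kappa>))) \<le> real C * 1"
        by (simp add: mult_ac)
      thus ?thesis using C0 by (simp only: mult_le_cancel_left_pos)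
    qed
    have ch: "cosh \<mu> - p * sinh \<mu> \<le> exp (- (\<kappa> * p\<^sup>2 / 2))"
      unfolding \<mu>_def using assms by (intro cosh_minus_sinh_le) auto
    have "0 \<le> cosh \<mu> - p * sinh \<mu>"
      using sinh_le_cosh_real[of \<mu>] mult_right_mono[of p 1 "sinh \<mu>"] assms \<mu> by (simp add: sinh_real_nonneg_iff)
    hence "(cosh \<mu> - p * sinh \<mu>) ^ m \<le> exp (- (\<kappa> * p\<^sup>2 / 2)) ^ m"
      using ch by (intro power_mono)
    also have "\<dots> = exp (- (real m * \<kappa> * p\<^sup>2 / 2))"
      by (simp flip: exp_of_nat_mult)
    finally have chm: "(cosh \<mu> - p * sinh \<mu>) ^ m \<le> exp (- (real m * \<kappa> * p\<^sup>2 / 2))" .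
    have "(\<Sum>a\<in>?A. ?F a) = (\<Sum>a\<in>?I. ?F a) + (\<Sum>a\<in>?N. ?F a)"
      using finA by (subst sum.union_disjoint[symmetric]) (auto intro!: sum.cong)
    also have "(\<Sum>a\<in>?I. ?F a) \<le> real (card ?I) * 2 ^ n * (cosh \<mu> - p * sinh \<mu>) ^ m"
      unfolding m_def using C0 \<mu> \<tau> by (intro sum_noncollision_le[OF M(1)] assms) auto
    also have "\<dots> \<le> real (card ?I) * 2 ^ n * exp (- (real m * \<kappa> * p\<^sup>2 / 2))"
      using chm by (intro mult_left_mono) auto
    also have "(\<Sum>a\<in>?N. ?F a) \<le> (\<Sum>a\<in>?N. 2 ^ n * (1 + y\<^sup>2 * exp y))"
      using sum_collision_le[OF M(1) assms(4) \<mu>, of \<tau> x] \<tau>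
      by (intro sum_mono) (auto simp: y_def m_def \<mu>_def PiE_iff)
    also have "(\<Sum>a\<in>?N. 2 ^ n * (1 + y\<^sup>2 * exp y)) = real (card ?N) * (2 ^ n * (1 + y\<^sup>2 * exp y))"
      by simp
    also have "real (card ?I) * 2 ^ n * exp (- (real m * \<kappa> * p\<^sup>2 / 2)) + real (card ?N) * (2 ^ n * (1 + y\<^sup>2 * exp y))
       = (2 * real C) ^ n * ((1 - P) * exp (- (real m * \<kappa> * p\<^sup>2 / 2)) + P * (1 + y\<^sup>2 * exp y))"
      unfolding cA cN power_mult_distrib by (simp only: distrib_left mult_ac)
    also have "\<dots> \<le> (2 * real C) ^ n * exp (- (real m * \<kappa> * p\<^sup>2 / 4))"
      unfolding y_def using assms m P0 Pm by (intro mult_left_mono row_mixture_le) auto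
    finally show "(\<Sum>a\<in>?A. ?F a) \<le> (2 * real C) ^ n * exp (- a)"
      unfolding a_def by simp
  qed (use assms C0 in auto)
  also have "\<dots> = (2 * exp (- (\<kappa> * p\<^sup>2 * real R / 4))) ^ card M"
    by (simp add: a_def m_def power_mult_distrib flip: exp_of_nat_mult)
  finally show ?thesis .
qed

text \<open>A single coordinate cannot collide with itself, so the Chernoff parameter need not be
  small. The resulting base 2/sqrt c can be made arbitrarily small through \<open>c\<close>.\<close>

lemma single_tail_le:
  assumes "i < n" "1 \<le> R" "0 \<le> \<epsilon>" "2 \<le> c" "1 \<le> C"
    and p: "\<And>I. I \<subseteq> {0..<n} \<Longrightarrow> 1 - 2 / c \<le> bexp x (1 / real C) I (\<lambda>y. of_bool (\<bar>y\<bar> \<le> \<epsilon>))"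
  shows "measure_pmf.prob (fully_random R n C)
      {(h, s). \<epsilon> < \<bar>cs_estimate R n h s x i - x i\<bar>} \<le> 2 * (2 / sqrt c) ^ R"
proof -
  \<comment> \<open>With exp \<mu> = sqrt c the two parts of the row average, exp(-\<mu>) and (2/c)
    sinh \<mu>, are each at most 1/sqrt c.\<close>
  define \<mu> where "\<mu> = ln (sqrt c)"
  have \<mu>: "0 \<le> \<mu>" "exp \<mu> = sqrt c" "exp (- \<mu>) = 1 / sqrt c"
    using assms by (simp_all add: \<mu>_def exp_minus inverse_eq_divide)
  have "sqrt c * (1 / c) = 1 / sqrt c"
    using assms real_div_sqrt[of c] by (simp add: field_simps)
  hence \<rho>: "cosh \<mu> - (1 - 2 / c) * sinh \<mu> \<le> 2 / sqrt c"
    using assms by (simp add: cosh_def sinh_def \<mu> field_simps)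
  have "measure_pmf.prob (fully_random R n C)
      {(h, s). \<forall>i\<in>{i}. \<epsilon> < \<bar>cs_estimate R n h s x i - x i\<bar>} \<le> 2 ^ card {i} * (2 / sqrt c) ^ R"
  proof (rule joint_tail_le)
    fix \<tau> :: "nat \<Rightarrow> real" assume \<tau>: "\<tau> \<in> {i} \<rightarrow>\<^sub>E {-1, 1}"
    let ?A = "{0..<n} \<rightarrow>\<^sub>E {0..<C}"
    \<comment> \<open>For one coordinate the admissible range contains only
      \<open>C' = C\<close>.\<close>
    have p': "1 - 2 / c \<le> bexp x (1 / real C') I (\<lambda>y. of_bool (\<bar>y\<bar> \<le> \<epsilon>))"
      if "I \<subseteq> {0..<n}" "C - card {i} < C'" "C' \<le> C" for I C'
      using that p[OF that(1)] by (cases "C' = C") auto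
    have "(\<Sum>a\<in>?A. \<Sum>b\<in>{0..<n} \<rightarrow>\<^sub>E {-1, 1}. \<Prod>i\<in>{i}. pen \<mu> \<epsilon> (\<tau> i * row_noise n x a b i))
       \<le> real (card ?A) * 2 ^ n * (cosh \<mu> - (1 - 2 / c) * sinh \<mu>) ^ card {i}"
      using sum_noncollision_le[OF _ assms(5,3) \<mu>(1) \<tau> _ _ p'] assms by simp
    also have "\<dots> = (2 * real C) ^ n * (cosh \<mu> - (1 - 2 / c) * sinh \<mu>)"
      by (simp add: card_funcsetE power_mult_distrib)
    also have "\<dots> \<le> (2 * real C) ^ n * (2 / sqrt c)"
      using \<rho> by (intro mult_left_mono) auto
    finally show "(\<Sum>a\<in>?A. \<Sum>b\<in>{0..<n} \<rightarrow>\<^sub>E {-1, 1}. \<Prod>i\<in>{i}. pen \<mu> \<epsilon> (\<tau> i * row_noise n x a b i))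
       \<le> (2 * real C) ^ n * (2 / sqrt c)" .
  qed (use assms \<mu> in auto)
  thus ?thesis by simp
qed

subsection \<open>Head and tail of the vector\<close>

text \<open>By Bernoulli's inequality all of the at most k heavy coordinates avoid the bucket with
  probability at least 1 - k \<theta>, and then only the tail contributes.\<close>

lemma bexp_head_tail_ge:
  fixes x :: "nat \<Rightarrow> real"
  assumes "finite H" "card H \<le> k" "I \<subseteq> {0..<n}" "0 \<le> \<theta>" "\<theta> \<le> 1" "0 \<le> g"
    "g \<le> bexp x \<theta> (I - H) (\<lambda>y. of_bool (\<bar>y\<bar> \<le> \<epsilon>))"
  shows "(1 - real k * \<theta>) * g \<le> bexp x \<theta> I (\<lambda>y. of_bool (\<bar>y\<bar> \<le> \<epsilon>))"
proof -
  have "card (I \<inter> H) \<le> k"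
    using card_mono[of H "I \<inter> H"] assms by auto
  hence "1 - real k * \<theta> \<le> 1 + real (card (I \<inter> H)) * (- \<theta>)"
    using assms by (simp add: mult_right_mono)
  also have "\<dots> \<le> (1 + - \<theta>) ^ card (I \<inter> H)"
    using assms by (intro Bernoulli_inequality) auto
  finally have "(1 - real k * \<theta>) * g \<le> (1 - \<theta>) ^ card (I \<inter> H) * g"
    using assms by (intro mult_right_mono) auto
  also have "\<dots> \<le> (1 - \<theta>) ^ card (I \<inter> H) * bexp x \<theta> (I - H) (\<lambda>y. of_bool (\<bar>y\<bar> \<le> \<epsilon>))"
    using assms by (intro mult_left_mono) auto
  also have "\<dots> \<le> bexp x \<theta> (I \<inter> H \<union> (I - H)) (\<lambda>y. of_bool (\<bar>y\<bar> \<le> \<epsilon>))"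
    using assms finite_subset[OF assms(3)] by (intro bexp_Un_ge) auto
  also have "I \<inter> H \<union> (I - H) = I" by auto
  finally show ?thesis .
qed

lemma tail_sum_mono:
  fixes x :: "nat \<Rightarrow> real"
  assumes "I \<subseteq> {0..<n}"
  shows "(\<Sum>j\<in>I - H. (x j)\<^sup>2) \<le> (\<Sum>j\<in>{0..<n} - H. (x j)\<^sup>2)"
  using assms by (intro sum_mono2) auto

text \<open>One factor 1 - 1/c for the head avoiding the bucket and one for Chebyshev on the tail;
  their product is at least 1 - 2/c.\<close>

lemma bexp_tail_chebyshev:
  fixes x :: "nat \<Rightarrow> real"
  assumes "finite H" "card H \<le> k" "I \<subseteq> {0..<n}" "0 \<le> \<epsilon>" "1 \<le> k" "1 \<le> c"
    "(\<Sum>j\<in>{0..<n} - H. (x j)\<^sup>2) \<le> real k * \<epsilon>\<^sup>2"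
  shows "1 - 2 / real c \<le> bexp x (1 / real (c * k)) I (\<lambda>y. of_bool (\<bar>y\<bar> \<le> \<epsilon>))"
proof -
  have ck: "1 \<le> real c * real k" using assms by (simp flip: of_nat_mult)
  have "(\<Sum>j\<in>I - H. (x j)\<^sup>2) \<le> real k * \<epsilon>\<^sup>2"
    using tail_sum_mono[OF assms(3)] assms(7) by (rule order_trans)
  hence "1 - 1 / real c \<le> bexp x (1 / real (c * k)) (I - H) (\<lambda>y. of_bool (\<bar>y\<bar> \<le> \<epsilon>))"
    using assms ck finite_subset[OF assms(3)] by (intro bexp_chebyshev) (auto simp: field_simps)
  moreover have "0 \<le> 1 - 1 / real c" using assms by simp
  ultimately have "(1 - real k * (1 / real (c * k))) * (1 - 1 / real c)
      \<le> bexp x (1 / real (c * k)) I (\<lambda>y. of_bool (\<bar>y\<bar> \<le> \<epsilon>))"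
    using assms ck by (intro bexp_head_tail_ge) auto
  moreover have "(1 - real k * (1 / real (c * k))) * (1 - 1 / real c) = 1 - 2 / real c + (1 / real c)\<^sup>2"
    using assms by (simp add: field_simps power2_eq_square)
  ultimately show ?thesis
    by (smt (verit) zero_le_power2)
qed

text \<open>While buckets are being revealed at least half of the ck remain, so the conditional
  variance is at most 2/(ck) times the tail, and the head is avoided with probability at least
  1/2.\<close>

lemma bexp_tail_anticoncentration:
  fixes x :: "nat \<Rightarrow> real"
  assumes "finite H" "card H \<le> k" "I \<subseteq> {0..<n}" "0 \<le> \<epsilon>" "1 \<le> k" "4 \<le> c"
    and C': "real (c * k) \<le> 2 * real C'" and "0 < r" "r \<le> 1"
    and r: "r\<^sup>2 * (2 * (\<Sum>j\<in>{0..<n} - H. (x j)\<^sup>2)) \<le> real (c * k) * \<epsilon>\<^sup>2"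
  shows "r / 20 \<le> bexp x (1 / real C') I (\<lambda>y. of_bool (\<bar>y\<bar> \<le> \<epsilon>))"
proof -
  let ?\<theta> = "1 / real C'" and ?\<sigma> = "\<Sum>j\<in>{0..<n} - H. (x j)\<^sup>2"
  have "4 * real k \<le> real (c * k)" using assms by simp
  hence Ck: "2 * real k \<le> real C'" using C' by linarith
  hence C0: "2 \<le> real C'" using assms by simp
  have "r\<^sup>2 * (?\<theta> * (\<Sum>j\<in>I - H. (x j)\<^sup>2)) \<le> r\<^sup>2 * (?\<theta> * ?\<sigma>)"
    using tail_sum_mono[OF assms(3)] by (intro mult_left_mono) auto
  also have "\<dots> \<le> \<epsilon>\<^sup>2"
  proof -
    have "r\<^sup>2 * (2 * ?\<sigma>) \<le> (2 * real C') * \<epsilon>\<^sup>2"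
      using r C' by (meson mult_right_mono order_trans zero_le_power2)
    thus ?thesis using C0 by (simp add: field_simps)
  qed
  finally have "r / 10 \<le> bexp x ?\<theta> (I - H) (\<lambda>y. of_bool (\<bar>y\<bar> \<le> \<epsilon>))"
    using assms C0 finite_subset[OF assms(3)] by (intro bexp_anticoncentration) auto
  hence "(1 - real k * ?\<theta>) * (r / 10) \<le> bexp x ?\<theta> I (\<lambda>y. of_bool (\<bar>y\<bar> \<le> \<epsilon>))"
    using assms C0 by (intro bexp_head_tail_ge) auto
  moreover have "1 / 2 * (r / 10) \<le> (1 - real k * ?\<theta>) * (r / 10)"
    using Ck C0 assms by (intro mult_right_mono) (auto simp: field_simps)
  ultimately show ?thesis by linarith
qed

text \<open>Sorting the indices by their squares yields the same list of values as sorting the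
  squares, so dropping k values amounts to removing a set of at most k indices, ties
  included.\<close>

lemma tail_sq_head:
  obtains H where "finite H" "card H \<le> k" "(\<Sum>j\<in>{0..<n} - H. (x j)\<^sup>2) = tail_sq n k x"
proof -
  define js where "js = rev (sort_key (\<lambda>i. (x i)\<^sup>2) [0..<n])"
  have "sort (map (\<lambda>i. (x i)\<^sup>2) [0..<n]) = map (\<lambda>i. (x i)\<^sup>2) (sort_key (\<lambda>i. (x i)\<^sup>2) [0..<n])"
    by (rule properties_for_sort) auto
  hence "tail_sq n k x = sum_list (map (\<lambda>i. (x i)\<^sup>2) (drop k js))"
    by (simp add: tail_sq_def js_def rev_map drop_map)
  also have "\<dots> = (\<Sum>j\<in>set (drop k js). (x j)\<^sup>2)"
    by (rule sum_list_distinct_conv_sum_set) (simp add: js_def)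
  also have "set (drop k js) = {0..<n} - set (take k js)"
  proof -
    have "set js = set (take k js) \<union> set (drop k js)"
      by (metis append_take_drop_id set_append)
    moreover have "set (take k js) \<inter> set (drop k js) = {}"
      by (rule set_take_disj_set_drop_if_distinct) (auto simp: js_def)
    moreover have "set js = {0..<n}" by (simp add: js_def)
    ultimately show ?thesis by blast
  qed
  finally have "(\<Sum>j\<in>{0..<n} - set (take k js). (x j)\<^sup>2) = tail_sq n k x" ..
  moreover have "card (set (take k js)) \<le> k"
    by (rule order_trans[OF card_length]) simp
  ultimately show ?thesis by (intro that[of "set (take k js)"]) auto
qed

subsection \<open>From tail bounds to the sum of squares\<close>

text \<open>A discrete layer-cake bound with steps T/2: \<open>w\<close> is at most T/2 times one
  more than the number of levels it exceeds.\<close>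

lemma layer_pointwise:
  fixes w T :: real
  assumes "0 \<le> T" "1 \<le> L" "w \<le> real L / 2 * T"
  shows "w \<le> T / 2 * (1 + (\<Sum>l\<in>{1..<L}. of_bool (real l / 2 * T < w)))"
  using assms(2,3)
proof (induction L rule: nat_induct_at_least)
  case (Suc L)
  show ?case
  proof (cases "w \<le> real L / 2 * T")
    case True
    hence "w \<le> T / 2 * (1 + (\<Sum>l\<in>{1..<L}. of_bool (real l / 2 * T < w)))"
      by (rule Suc.IH)
    also have "\<dots> \<le> T / 2 * (1 + (\<Sum>l\<in>{1..<Suc L}. of_bool (real l / 2 * T < w)))"
      using assms(1) by (intro mult_left_mono add_left_mono sum_mono2) auto
    finally show ?thesis .
  next
    case False
    have "(\<Sum>l\<in>{1..<Suc L}. of_bool (real l / 2 * T < w)) = (\<Sum>l\<in>{1..<Suc L}. 1 :: real)"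
    proof (intro sum.cong refl)
      fix l assume "l \<in> {1..<Suc L}"
      hence "real l / 2 * T \<le> real L / 2 * T"
        using assms(1) by (intro mult_right_mono) auto
      thus "of_bool (real l / 2 * T < w) = (1 :: real)" using False by auto
    qed
    thus ?thesis using Suc.prems by (simp add: algebra_simps)
  qed
qed (use assms(1) in simp)

lemma sum_inverse_le_1: "(\<Sum>l\<in>{1..<L}. 1 / (real l * (real l + 1))) \<le> 1"
proof -
  have "(\<Sum>l\<in>{1..<Suc L}. 1 / (real l * (real l + 1))) = 1 - 1 / (real L + 1)" for L
  proof (induction L)
    case (Suc L)
    have "(\<Sum>l\<in>{1..<Suc (Suc L)}. 1 / (real l * (real l + 1))) = 1 - 1 / (real L + 1) + 1 / ((real L + 1) * (real L + 2))"
      using Suc.IH by (subst sum.atLeastLessThan_Suc) (simp_all add: add_ac)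
    also have "\<dots> = 1 - 1 / (real (Suc L) + 1)"
      by (simp add: divide_simps) (simp add: algebra_simps)
    finally show ?case .
  qed simp
  from this[of "L - 1"] show ?thesis by (cases L) auto
qed

text \<open>Half of the budget T pays the base step T/2 of every coordinate. The other half pays for
  the exceeded levels, whose counts are bounded by a telescoping series with sum at most 1.\<close>

lemma layer_sum_le:
  fixes w :: "'a \<Rightarrow> real"
  assumes "finite S" "0 \<le> T" "1 \<le> L" and top: "\<And>i. i \<in> S \<Longrightarrow> w i \<le> real L / 2 * T"
    and lev: "\<And>l. l \<in> {1..<L} \<Longrightarrow> real (card {i\<in>S. real l / 2 * T < w i}) \<le> real (card S) / (real l * (real l + 1))"
  shows "(\<Sum>i\<in>S. w i) \<le> real (card S) * T"
proof -
  have "(\<Sum>i\<in>S. w i) \<le> (\<Sum>i\<in>S. T / 2 * (1 + (\<Sum>l\<in>{1..<L}. of_bool (real l / 2 * T < w i))))"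
    using assms by (intro sum_mono layer_pointwise) auto
  also have "\<dots> = T / 2 * (real (card S) + (\<Sum>i\<in>S. \<Sum>l\<in>{1..<L}. of_bool (real l / 2 * T < w i)))"
    by (simp only: sum_distrib_left[symmetric] sum.distrib sum_constant mult_1_right)
  also have "\<dots> = T / 2 * (real (card S) + (\<Sum>l\<in>{1..<L}. \<Sum>i\<in>S. of_bool (real l / 2 * T < w i)))"
    by (subst sum.swap) (rule refl)
  also have "\<dots> = T / 2 * (real (card S) + (\<Sum>l\<in>{1..<L}. real (card {i\<in>S. real l / 2 * T < w i})))"
    using assms(1) by (simp add: Int_def)
  also have "\<dots> \<le> T / 2 * (real (card S) + (\<Sum>l\<in>{1..<L}. real (card S) * (1 / (real l * (real l + 1)))))"
    using assms(2) lev by (intro mult_left_mono add_left_mono sum_mono) auto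
  also have "\<dots> \<le> T / 2 * (real (card S) + real (card S) * 1)"
    unfolding sum_distrib_left[symmetric]
    using assms(2) by (intro mult_left_mono add_left_mono sum_inverse_le_1) auto
  finally show ?thesis by (simp add: mult.commute)
qed

section \<open>Counting bad coordinates by Markov's inequality\<close>

lemma prob_le_sum_of_cover:
  fixes Q :: "'b pmf"
  assumes "finite F" "\<And>\<omega>. \<omega> \<in> A \<Longrightarrow> c \<le> (\<Sum>M\<in>F. indicat_real (E M) \<omega>)"
  shows "c * measure_pmf.prob Q A \<le> (\<Sum>M\<in>F. measure_pmf.prob Q (E M))"
proof -
  have "c * measure_pmf.prob Q A = (\<integral>\<omega>. c * indicat_real A \<omega> \<partial>measure_pmf Q)"
    by simp
  also have "\<dots> \<le> (\<integral>\<omega>. (\<Sum>M\<in>F. indicat_real (E M) \<omega>) \<partial>measure_pmf Q)"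
  proof (rule integral_mono)
    show "integrable (measure_pmf Q) (\<lambda>\<omega>. c * indicat_real A \<omega>)"
      by (intro integrable_mult_right integrable_real_indicator) (auto simp: measure_pmf.emeasure_eq_measure)
    show "integrable (measure_pmf Q) (\<lambda>\<omega>. \<Sum>M\<in>F. indicat_real (E M) \<omega>)"
      by (intro Bochner_Integration.integrable_sum integrable_real_indicator) (auto simp: measure_pmf.emeasure_eq_measure)
    show "c * indicat_real A \<omega> \<le> (\<Sum>M\<in>F. indicat_real (E M) \<omega>)" for \<omega>
      using assms(2)[of \<omega>] by (cases "\<omega> \<in> A") (auto intro: sum_nonneg)
  qed
  also have "\<dots> = (\<Sum>M\<in>F. measure_pmf.prob Q (E M))"
    by (subst Bochner_Integration.integral_sum)
       (auto intro!: integrable_real_indicator simp: measure_pmf.emeasure_eq_measure)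
  finally show ?thesis .
qed

lemma power_self_le_exp_fact: "real m ^ m \<le> exp (real m) * fact m"
proof -
  have "(\<Sum>i\<in>{m}. real m ^ i /\<^sub>R fact i) \<le> (\<Sum>i. real m ^ i /\<^sub>R fact i)"
    by (intro sum_le_suminf summable_exp_generic) auto
  hence "real m ^ m / fact m \<le> exp (real m)"
    by (simp add: exp_def field_simps)
  thus ?thesis by (simp add: field_simps)
qed

text \<open>Markov's inequality for the number of \<open>m\<close>-element subsets all of whose members are bad.\<close>

lemma prob_many_bad_le:
  fixes Q :: "'b pmf" and B :: "'a \<Rightarrow> 'b set"
  assumes "finite S" "1 \<le> m" "real m \<le> q" "0 \<le> \<pi>"
    and joint: "\<And>M. M \<subseteq> S \<Longrightarrow> card M = m \<Longrightarrow> measure_pmf.prob Q {\<omega>. \<forall>i\<in>M. \<omega> \<in> B i} \<le> \<pi> ^ m"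
  shows "measure_pmf.prob Q {\<omega>. q < real (card {i\<in>S. \<omega> \<in> B i})} \<le> (exp 1 * real (card S) / q * \<pi>) ^ m"
proof -
  let ?F = "{M. M \<subseteq> S \<and> card M = m}" and ?A = "{\<omega>. q < real (card {i\<in>S. \<omega> \<in> B i})}"
  have finF: "finite ?F" using assms(1) by auto
  have q0: "0 < q" using assms by linarith
  have "(q / real m) ^ m * measure_pmf.prob Q ?A \<le> (\<Sum>M\<in>?F. measure_pmf.prob Q {\<omega>. \<forall>i\<in>M. \<omega> \<in> B i})"
  proof (rule prob_le_sum_of_cover[OF finF])
    fix \<omega> assume "\<omega> \<in> ?A"
    define Z where "Z = {i\<in>S. \<omega> \<in> B i}"
    have Z: "q \<le> real (card Z)" "finite Z" "m \<le> card Z"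
      using \<open>\<omega> \<in> ?A\<close> assms by (auto simp: Z_def)
    have "(q / real m) ^ m \<le> (real (card Z) / real m) ^ m"
      using Z q0 by (intro power_mono divide_right_mono) auto
    \<comment> \<open>More than q bad coordinates contain at least (q/m)^m bad m-subsets, which is
      the threshold for Markov.\<close>
    also have "\<dots> \<le> real (card Z choose m)"
      by (rule binomial_ge_n_over_k_pow_k[OF Z(3)])
    also have "card Z choose m = card {M. M \<subseteq> Z \<and> card M = m}"
      using n_subsets[OF Z(2), of m] by simp
    also have "{M. M \<subseteq> Z \<and> card M = m} = {M \<in> ?F. \<omega> \<in> {\<omega>. \<forall>i\<in>M. \<omega> \<in> B i}}"
      by (auto simp: Z_def)
    also have "real (card \<dots>) = (\<Sum>M\<in>?F. indicat_real {\<omega>. \<forall>i\<in>M. \<omega> \<in> B i} \<omega>)"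
      using finF by (simp add: indicator_def Int_def)
    finally show "(q / real m) ^ m \<le> (\<Sum>M\<in>?F. indicat_real {\<omega>. \<forall>i\<in>M. \<omega> \<in> B i} \<omega>)" .
  qed
  also have "\<dots> \<le> (\<Sum>M\<in>?F. \<pi> ^ m)"
    using joint by (intro sum_mono) auto
  also have "\<dots> = real (card S choose m) * \<pi> ^ m"
    using n_subsets[OF assms(1), of m] by simp
  also have "\<dots> \<le> (exp 1 * real (card S) / real m) ^ m * \<pi> ^ m"
  proof (intro mult_right_mono)
    have "real (card S choose m) * fact m \<le> real (card S) ^ m"
      using binomial_fact_pow[of "card S" m] by (metis of_nat_fact of_nat_le_iff of_nat_mult of_nat_power)
    hence "real (card S choose m) * fact m * real m ^ m \<le> real (card S) ^ m * (exp (real m) * fact m)"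
      using power_self_le_exp_fact[of m] by (intro mult_mono) auto
    moreover have "exp (real m) = exp (1 :: real) ^ m"
      by (simp flip: exp_of_nat_mult)
    ultimately show "real (card S choose m) \<le> (exp 1 * real (card S) / real m) ^ m"
      using assms(2) by (simp add: power_divide power_mult_distrib field_simps)
  qed (use assms in auto)
  \<comment> \<open>Against the threshold (q/m)^m the denominator m cancels, leaving only the ratio
    of |S| to q.\<close>
  also have "\<dots> = (q / real m) ^ m * (exp 1 * real (card S) / q * \<pi>) ^ m"
    using q0 by (simp flip: power_mult_distrib)
  finally have "(q / real m) ^ m * measure_pmf.prob Q ?A \<le> (q / real m) ^ m * (exp 1 * real (card S) / q * \<pi>) ^ m" .
  thus ?thesis
    using q0 assms(2) by (simp only: mult_le_cancel_left_pos zero_less_power divide_pos_pos of_nat_0_less_iff Suc_le_eq One_nat_def)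
qed

section \<open>Growth estimates behind the choice of constants\<close>

lemma eventually_polylog_le:
  fixes D L0 :: real
  assumes "0 < D" "0 < L0"
  shows "\<forall>\<^sub>F N in sequentially. 4 * (D * ln (real N) + 1) ^ 3 * (exp 1 * real N powr (1 / 4)) \<le> real N \<and>
    (L0 * ln (real N) + 1)\<^sup>2 * (D * ln (real N) + 1) \<le> real N \<and> L0 * ln (real N) + 1 \<le> real N"
proof (intro eventually_conj)
  show "\<forall>\<^sub>F N in sequentially. 4 * (D * ln (real N) + 1) ^ 3 * (exp 1 * real N powr (1 / 4)) \<le> real N"
    using assms by real_asymp
  show "\<forall>\<^sub>F N in sequentially. (L0 * ln (real N) + 1)\<^sup>2 * (D * ln (real N) + 1) \<le> real N"
    using assms by real_asymp
  show "\<forall>\<^sub>F N in sequentially. L0 * ln (real N) + 1 \<le> real N"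
    using assms by real_asymp
qed

text \<open>The Markov base for level l is e l(l+1) times the per-coordinate bound. If R attains the
  minimum, l(l+1) \<le> 4 R^2 is beaten by exp(\<gamma> R) for large R; otherwise the exponent
  \<gamma> l c / 4 \<ge> 6 l beats l(l+1).\<close>

lemma level_factor_le:
  fixes \<gamma> :: real
  assumes "1 \<le> l" "l < 2 * R" "24 \<le> \<gamma> * real c" "0 < \<gamma>" "8 * exp 2 * (real R)\<^sup>2 \<le> exp (\<gamma> * real R)"
  shows "exp 1 * (real l * (real l + 1)) * (2 * exp (- (\<gamma> * min (real R) (real l * real c / 4)))) \<le> exp (- 1)"
proof -
  define X where "X = exp (\<gamma> * min (real R) (real l * real c / 4))"
  have "2 * exp 2 * (real l * (real l + 1)) \<le> X"
  proof (cases "real R \<le> real l * real c / 4")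
    case True
    have "real l * (real l + 1) \<le> (2 * real R) * (2 * real R)"
      using assms(2) by (intro mult_mono) auto
    hence "2 * exp 2 * (real l * (real l + 1)) \<le> 2 * exp 2 * ((2 * real R) * (2 * real R))"
      by (intro mult_left_mono) auto
    also have "\<dots> = 8 * exp 2 * (real R)\<^sup>2" by (simp add: power2_eq_square)
    also note assms(5)
    finally show ?thesis using True by (simp add: X_def)
  next
    case False
    have l: "1 \<le> real l" using assms(1) by simp
    have e: "real l + 1 \<le> exp (real l)" using exp_ge_add_one_self[of "real l"] by (simp add: add.commute)
    have "(2 :: real) \<le> exp 2" using exp_ge_add_one_self[of 2] by (simp add: order_trans[rotated])
    hence "2 * exp 2 * (real l * (real l + 1)) \<le> exp 2 * exp 2 * (exp (real l) * exp (real l))"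
      using e by (intro mult_mono) auto
    also have "\<dots> = exp (4 + 2 * real l)" by (simp flip: exp_add)
    also have "\<dots> \<le> exp (6 * real l)" using l by simp
    also have "\<dots> \<le> exp (\<gamma> * (real l * real c / 4))"
    proof -
      have "real l * 24 \<le> real l * (\<gamma> * real c)" using assms(3) by (intro mult_left_mono) auto
      thus ?thesis by (simp add: mult_ac)
    qed
    finally show ?thesis using False by (simp add: X_def)
  qed
  moreover have "exp 2 = exp 1 * (exp 1 :: real)"
    by (simp flip: exp_add)
  moreover have "0 < X" by (simp add: X_def)
  ultimately show ?thesis
    unfolding exp_minus X_def[symmetric] by (simp add: field_simps)
qed

section \<open>Assembly: constants, levels and the union bound\<close>

theorem theorem6p5:
  "\<forall>d::real>0. \<forall>A::real>0. \<exists>(c0::nat) (K::real).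
     \<forall>(n::nat) (k::nat) (c::nat) (R::nat) (x::nat \<Rightarrow> real) (S::nat set).
       n \<ge> 1 \<longrightarrow> k \<ge> 1 \<longrightarrow> c \<ge> c0 \<longrightarrow> R \<ge> 1 \<longrightarrow> ln (real k) \<le> A * real R \<longrightarrow>
       S \<subseteq> {0..<n} \<longrightarrow> S \<noteq> {} \<longrightarrow> card S \<le> k \<longrightarrow>
       measure_pmf.prob (fully_random R n (c * k))
         {(h, s). (\<Sum>i\<in>S. (cs_estimate R n h s x i - x i)\<^sup>2)
                   > real (card S) * (1 / real R) * (tail_sq n k x / real k)}
       \<le> K / real (card S) powr d"
proof (intro allI impI)
  fix d A :: real assume d: "0 < d" and A: "0 < A"
  \<comment> \<open>The extra 1 in \<open>D\<close> pays for the union bound over \<open>S\<close>.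
    The choice of \<kappa> makes exp(2 m \<kappa>) about N^(1/4) for m near D ln N.
    Anticoncentration r/20 turns \<kappa>/4 into \<gamma> = \<kappa>/1600. \<open>L0\<close> is such
    that \<gamma> L / 2 \<ge> D ln N once L \<ge> L0 ln N.\<close>
  define D \<kappa> \<gamma> L0 where "D = d + 1" and "\<kappa> = 1 / (8 * D)" and "\<gamma> = \<kappa> / 1600" and "L0 = 2 * D / \<gamma>"
  have pos: "1 < D" "0 < \<kappa>" "\<kappa> \<le> 1 / 8" "0 < \<gamma>" "0 < L0"
  proof -
    show D: "1 < D" using d by (simp add: D_def)
    show \<kappa>: "0 < \<kappa>" "\<kappa> \<le> 1 / 8" using D by (simp_all add: \<kappa>_def)
    show \<gamma>: "0 < \<gamma>" using \<kappa> by (simp add: \<gamma>_def)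
    show "0 < L0" using D \<gamma> by (simp add: L0_def)
  qed
  have "\<forall>\<^sub>F R in sequentially. 8 * exp 2 * (real R)\<^sup>2 \<le> exp (\<gamma> * real R)"
    using pos(4) by real_asymp
  then obtain R0 where R0: "\<And>R. R0 \<le> R \<Longrightarrow> 8 * exp 2 * (real R)\<^sup>2 \<le> exp (\<gamma> * real R)"
    unfolding eventually_sequentially by blast
  obtain N1 where N1: "\<And>N. N1 \<le> N \<Longrightarrow> 4 * (D * ln (real N) + 1) ^ 3 * (exp 1 * real N powr (1 / 4)) \<le> real N"
    "\<And>N. N1 \<le> N \<Longrightarrow> (L0 * ln (real N) + 1)\<^sup>2 * (D * ln (real N) + 1) \<le> real N"
    "\<And>N. N1 \<le> N \<Longrightarrow> L0 * ln (real N) + 1 \<le> real N"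
    using eventually_polylog_le[of D L0] pos unfolding eventually_sequentially by force
  \<comment> \<open>Sets smaller than \<open>N0\<close> are absorbed into the constant
    \<open>K\<close>. The last summand guarantees R \<ge> R0 for the others, since A R0 \<le> ln |S|
    \<le> ln k \<le> A R.\<close>
  define N0 where "N0 = N1 + 3 + nat \<lceil>exp (A * real R0)\<rceil>"
  have N0: "N1 \<le> N0" "3 \<le> N0" "exp (A * real R0) \<le> real N0"
    unfolding N0_def by (simp, simp) linarith
  \<comment> \<open>The summand 24/\<gamma> serves the levels, 4 exp(2DA) makes 2/sqrt c \<le>
    exp(-DA) for the top level, and 8 covers the collision condition for a single
    coordinate.\<close>
  define c0 where "c0 = 8 + nat \<lceil>24 / \<gamma>\<rceil> + nat \<lceil>4 * exp (2 * (D * A))\<rceil>"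
  have c0: "8 \<le> c0" "24 / \<gamma> \<le> real c0" "4 * exp (2 * (D * A)) \<le> real c0"
    unfolding c0_def by (simp, linarith, linarith)
  show "\<exists>(c0::nat) (K::real).
     \<forall>(n::nat) (k::nat) (c::nat) (R::nat) (x::nat \<Rightarrow> real) (S::nat set).
       n \<ge> 1 \<longrightarrow> k \<ge> 1 \<longrightarrow> c \<ge> c0 \<longrightarrow> R \<ge> 1 \<longrightarrow> ln (real k) \<le> A * real R \<longrightarrow>
       S \<subseteq> {0..<n} \<longrightarrow> S \<noteq> {} \<longrightarrow> card S \<le> k \<longrightarrow>
       measure_pmf.prob (fully_random R n (c * k))
         {(h, s). (\<Sum>i\<in>S. (cs_estimate R n h s x i - x i)\<^sup>2)
                   > real (card S) * (1 / real R) * (tail_sq n k x / real k)}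
       \<le> K / real (card S) powr d"
  proof (intro exI allI impI)
    fix n k c R :: nat and x :: "nat \<Rightarrow> real" and S :: "nat set"
    assume k: "1 \<le> k" and c: "c0 \<le> c" and R: "1 \<le> R" and kR: "ln (real k) \<le> A * real R"
      and S: "S \<subseteq> {0..<n}" "S \<noteq> {}" "card S \<le> k"
    define N C where "N = card S" and "C = c * k"
    define Q where "Q = fully_random R n C"
    define bad where "bad = {(h, s). (\<Sum>i\<in>S. (cs_estimate R n h s x i - x i)\<^sup>2)
                   > real N * (1 / real R) * (tail_sq n k x / real k)}"
    have finS: "finite S" using S finite_subset by blast
    have N: "1 \<le> N" using S finS by (simp add: N_def Suc_le_eq card_gt_0_iff)
    have "measure_pmf.prob Q bad \<le> (3 + real N0 powr d) / real N powr d"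
    proof (cases "N < N0")
      case True
      \<comment> \<open>For small \<open>S\<close> the claimed bound is at least 1.\<close>
      have "real N powr d \<le> real N0 powr d"
        using True d by (intro powr_mono2) auto
      hence "1 \<le> (3 + real N0 powr d) / real N powr d"
        using N by (simp add: field_simps)
      thus ?thesis using measure_pmf.prob_le_1[of Q bad] by linarith
    next
      case False
      hence NN: "N0 \<le> N" "N1 \<le> N" "3 \<le> N" using N0 by auto
      define \<Lambda> where "\<Lambda> = ln (real N)"
      have "1 < ln (3 :: real)" using ln3_gt_1 .
      also have "ln 3 \<le> \<Lambda>" unfolding \<Lambda>_def using NN by (intro ln_mono) auto
      finally have \<Lambda>: "1 < \<Lambda>" .
      have Nk: "N \<le> k" using S by (simp add: N_def)
      have \<Lambda>R: "\<Lambda> \<le> A * real R"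
        unfolding \<Lambda>_def using N Nk by (intro order_trans[OF ln_mono kR]) auto
      have "exp (A * real R0) \<le> real N" using N0(3) NN by linarith
      hence "A * real R0 \<le> \<Lambda>"
        unfolding \<Lambda>_def using N by (subst ln_ge_iff) auto
      hence "R0 \<le> R" using \<Lambda>R A by (smt (verit) mult_le_cancel_left_pos of_nat_le_iff)
      note R0 = R0[OF this]
      have cc: "8 \<le> c" "24 \<le> \<gamma> * real c" "4 * exp (2 * (D * A)) \<le> real c"
      proof -
        have "24 / \<gamma> \<le> real c" using c0 c by linarith
        thus "24 \<le> \<gamma> * real c" using pos by (simp add: field_simps)
      qed (use c0 c in linarith)+
      have C: "real C = real c * real k" "8 \<le> C" "1 \<le> C"
        using cc k mult_le_mono[of 8 c 1 k] by (auto simp: C_def)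
      have CN: "real N \<le> real C"
        using Nk cc k by (simp add: C_def) (metis mult_le_mono1 mult_1 le_trans One_nat_def Suc_leI gr0I of_nat_le_iff of_nat_mult not_numeral_le_zero)
      obtain H where H: "finite H" "card H \<le> k" "(\<Sum>j\<in>{0..<n} - H. (x j)\<^sup>2) = tail_sq n k x"
        using tail_sq_head by metis
      \<comment> \<open>\<open>T\<close> is the target average of the squared errors over
        \<open>S\<close>.\<close>
      define tl T where "tl = tail_sq n k x" and "T = tl / (real R * real k)"
      have tl: "0 \<le> tl" unfolding tl_def H(3)[symmetric] by (intro sum_nonneg) auto
      have T: "0 \<le> T" using tl by (simp add: T_def)
      have kT: "real k * (real R * T) = tl" using k R by (simp add: T_def)
      define w where "w \<omega> i = (cs_estimate R n (fst \<omega>) (snd \<omega>) x i - x i)\<^sup>2" for \<omega> i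
      define B where "B l i = {\<omega>. real l / 2 * T < w \<omega> i}" for l i
      have B_eq: "{\<omega>. \<forall>i\<in>M. \<omega> \<in> B l i} =
          {(h, s). \<forall>i\<in>M. sqrt (real l / 2 * T) < \<bar>cs_estimate R n h s x i - x i\<bar>}" for l M
      proof -
        have "real l / 2 * T < y\<^sup>2 \<longleftrightarrow> sqrt (real l / 2 * T) < \<bar>y\<bar>" for y
          by (metis real_sqrt_abs real_sqrt_less_iff)
        thus ?thesis by (auto simp: B_def w_def)
      qed
      define \<pi> where "\<pi> l = 2 * exp (- (\<gamma> * min (real R) (real l * real c / 4)))" for l
      have joint: "measure_pmf.prob Q {\<omega>. \<forall>i\<in>M. \<omega> \<in> B l i} \<le> \<pi> l ^ card M"
        if M: "M \<subseteq> S" "M \<noteq> {}" and l: "1 \<le> l"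
          and big: "4 * real (card M) ^ 3 * exp (2 * real (card M) * \<kappa>) \<le> real C" for M l
      proof -
        \<comment> \<open>r^2 is the squared threshold l T / 2 divided by the variance bound 2 tl /
          (ck), capped at 1.\<close>
        define r where "r = sqrt (min 1 (real l * real c / (4 * real R)))"
        have r0: "0 < min 1 (real l * real c / (4 * real R))"
          using l cc R by auto
        hence r: "0 < r" "r \<le> 1" "r\<^sup>2 = min 1 (real l * real c / (4 * real R))"
          by (auto simp: r_def)
        have m: "1 \<le> card M"
          using M finS finite_subset[OF M(1)] by (auto simp: Suc_le_eq card_gt_0_iff)
        have "2 * real (card M) \<le> real C"
        proof -
          have "2 * real (card M) * 1 \<le> 4 * real (card M) ^ 3 * exp (2 * real (card M) * \<kappa>)"
            using m pos self_le_power[of "real (card M)" 3] by (intro mult_mono) auto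
          thus ?thesis using big by linarith
        qed
        hence mC: "2 * card M \<le> C" by linarith
        have "r / 20 \<le> bexp x (1 / real C') I (\<lambda>y. of_bool (\<bar>y\<bar> \<le> sqrt (real l / 2 * T)))"
          if "I \<subseteq> {0..<n}" "C - card M < C'" "C' \<le> C" for I C'
        proof (rule bexp_tail_anticoncentration[OF H(1,2) that(1) _ k _ _ r(1,2)])
          show "real (c * k) \<le> 2 * real C'"
            using that mC unfolding C_def[symmetric] by linarith
          have "r\<^sup>2 * (2 * tl) \<le> real l * real c / (4 * real R) * (2 * tl)"
            unfolding r(3) using tl by (intro mult_right_mono) auto
          also have "\<dots> = real (c * k) * (real l / 2 * T)"
            using k R by (simp add: T_def field_simps)
          finally show "r\<^sup>2 * (2 * (\<Sum>j\<in>{0..<n} - H. (x j)\<^sup>2)) \<le> real (c * k) * (sqrt (real l / 2 * T))\<^sup>2"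
            using T H(3) by (simp add: tl_def)
        qed (use cc T in auto)
        hence "measure_pmf.prob Q {\<omega>. \<forall>i\<in>M. \<omega> \<in> B l i}
            \<le> (2 * exp (- (\<kappa> * (r / 20)\<^sup>2 * real R / 4))) ^ card M"
          unfolding B_eq Q_def using M S R T r pos big by (intro joint_tail_exp_le) auto
        also have "\<kappa> * (r / 20)\<^sup>2 * real R / 4 = \<gamma> * (real R * r\<^sup>2)"
          by (simp add: \<gamma>_def power_divide)
        also have "real R * r\<^sup>2 = min (real R) (real l * real c / 4)"
          unfolding r(3) using R by (simp add: min_mult_distrib_left)
        finally show ?thesis by (simp add: \<pi>_def)
      qed
      define Y where "Y = exp (- (D * \<Lambda>))"
      \<comment> \<open>The top level is the first of two places where a union bound over
        \<open>S\<close> works: at 2R the squared threshold is R T = tl / k, within reach of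
        Chebyshev, and at L0 ln N the level bound is already at most 2 N^(-D).\<close>
      define L where "L = min (2 * R) (nat \<lceil>L0 * \<Lambda>\<rceil>)"
      have L0\<Lambda>: "0 < L0 * \<Lambda>" using pos \<Lambda> by simp
      have L: "1 \<le> L" "real L \<le> L0 * \<Lambda> + 1" "L \<le> 2 * R"
        using R L0\<Lambda> by (auto simp: L_def min_def) linarith+
      have top: "measure_pmf.prob Q (B L i) \<le> 2 * Y" if i: "i \<in> S" for i
      proof (cases "L = 2 * R")
        case True
        have "measure_pmf.prob Q (B L i) = measure_pmf.prob Q {\<omega>. \<forall>i\<in>{i}. \<omega> \<in> B L i}" by simp
        also have "\<dots> \<le> 2 * (2 / sqrt (real c)) ^ R"
          unfolding B_eq Q_def using single_tail_le[of i n R "sqrt (real R * T)" "real c" C x]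
            bexp_tail_chebyshev[OF H(1,2), of _ n "sqrt (real R * T)" c x] i S R T cc k H(3) kT C
          by (simp add: True C_def tl_def subset_iff)
        \<comment> \<open>Here the size of \<open>c\<close> and the assumption ln k \<le> A R
          convert decay in R into decay in N.\<close>
        also have "\<dots> \<le> 2 * exp (- (D * A)) ^ R"
        proof (intro mult_left_mono power_mono)
          have "2 * exp (D * A) \<le> sqrt (real c)"
            using cc(3) by (intro real_le_rsqrt) (simp add: power_mult_distrib exp_double)
          thus "2 / sqrt (real c) \<le> exp (- (D * A))"
            using cc by (simp add: exp_minus field_simps)
        qed auto
        also have "\<dots> = 2 * exp (- (D * (A * real R)))"
          by (simp add: mult_ac flip: exp_of_nat_mult)
        also have "\<dots> \<le> 2 * Y"
          using \<Lambda>R pos by (simp add: Y_def)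
        finally show ?thesis .
      next
        case False
        hence LL: "L0 * \<Lambda> \<le> real L" "real L \<le> 2 * real R"
        proof -
          have "L = nat \<lceil>L0 * \<Lambda>\<rceil>"
            using False unfolding L_def by linarith
          thus "L0 * \<Lambda> \<le> real L" by (simp only: real_nat_ceiling_ge)
        qed (use L(3) in linarith)
        have "exp (2 * \<kappa>) \<le> 2"
          using exp_bound_half[of "2 * \<kappa>"] pos by simp
        hence "measure_pmf.prob Q {\<omega>. \<forall>i\<in>{i}. \<omega> \<in> B L i} \<le> \<pi> L ^ card {i}"
          using i L(1) C by (intro joint) auto
        also have "\<dots> \<le> 2 * Y"
        proof -
          \<comment> \<open>In this case L0 ln N \<le> L \<le> 2R, so both arguments of the minimum
            are at least L0 ln N / 2 = D ln N / \<gamma>.\<close>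
          have "real L / 2 \<le> real L * real c / 4"
            using cc mult_left_mono[of 2 "real c" "real L"] by simp
          moreover have "D / \<gamma> * \<Lambda> = L0 * \<Lambda> / 2" by (simp add: L0_def)
          ultimately have "D / \<gamma> * \<Lambda> \<le> real R" "D / \<gamma> * \<Lambda> \<le> real L * real c / 4"
            using LL by linarith+
          hence "D / \<gamma> * \<Lambda> \<le> min (real R) (real L * real c / 4)"
            by simp
          hence "\<gamma> * (D / \<gamma> * \<Lambda>) \<le> \<gamma> * min (real R) (real L * real c / 4)"
            using pos by (intro mult_left_mono) auto
          thus ?thesis using pos by (simp add: \<pi>_def Y_def)
        qed
        finally show ?thesis by simp
      qed
      \<comment> \<open>The subset size for Markov: a base of at most 1/e then gives exp(-m) \<le>
        N^(-D).\<close>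
      define m where "m = nat \<lceil>D * \<Lambda>\<rceil>"
      have D\<Lambda>: "0 < D * \<Lambda>" using pos \<Lambda> by simp
      have m: "1 \<le> m" "D * \<Lambda> \<le> real m" "real m \<le> D * \<Lambda> + 1"
        using D\<Lambda> by (auto simp: m_def) linarith+
      have mC: "4 * real m ^ 3 * exp (2 * real m * \<kappa>) \<le> real C"
      proof -
        have "2 * real m * \<kappa> \<le> 2 * (D * \<Lambda> + 1) * \<kappa>"
          using m pos by (intro mult_right_mono) auto
        also have "\<dots> \<le> 1 + \<Lambda> / 4"
          using pos by (simp add: \<kappa>_def field_simps)
        finally have "exp (2 * real m * \<kappa>) \<le> exp (1 + \<Lambda> / 4)" by simp
        also have "\<dots> = exp 1 * real N powr (1 / 4)"
          using N by (simp add: exp_add powr_def \<Lambda>_def)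
        finally have "4 * real m ^ 3 * exp (2 * real m * \<kappa>) \<le>
            4 * (D * \<Lambda> + 1) ^ 3 * (exp 1 * real N powr (1 / 4))"
          using m D\<Lambda> by (intro mult_mono power_mono) auto
        also have "\<dots> \<le> real N" using N1(1)[OF NN(2)] by (simp add: \<Lambda>_def)
        finally show ?thesis using CN by linarith
      qed
      define q where "q l = real N / (real l * (real l + 1))" for l
      define E where "E l = {\<omega>. q l < real (card {i\<in>S. \<omega> \<in> B l i})}" for l
      have level: "measure_pmf.prob Q (E l) \<le> Y" if l: "l \<in> {1..<L}" for l
      proof -
        have l1: "1 \<le> l" "l < L" using l by auto
        have "real l * (real l + 1) \<le> real L * real L"
          using l1 by (intro mult_mono) auto
        also have "\<dots> \<le> (L0 * \<Lambda> + 1)\<^sup>2"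
          unfolding power2_eq_square using L L0\<Lambda> by (intro mult_mono) auto
        finally have "real l * (real l + 1) * real m \<le> (L0 * \<Lambda> + 1)\<^sup>2 * (D * \<Lambda> + 1)"
          using m by (intro mult_mono) auto
        also have "\<dots> \<le> real N" using N1(2)[OF NN(2)] by (simp add: \<Lambda>_def)
        finally have "real m * (real l * (real l + 1)) \<le> real N"
          by (simp only: mult.commute)
        moreover have "0 < real l * (real l + 1)" using l1 by simp
        \<comment> \<open>Markov needs m \<le> q l. Since l < L is at most of order ln N, q l is N
          up to logarithmic factors, while m is logarithmic.\<close>
        ultimately have mq: "real m \<le> q l"
          unfolding q_def by (simp only: pos_le_divide_eq)
        have "measure_pmf.prob Q (E l) \<le> (exp 1 * real (card S) / q l * \<pi> l) ^ m"
          unfolding E_def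
        proof (rule prob_many_bad_le[OF finS m(1) mq])
          fix M assume M: "M \<subseteq> S" "card M = m"
          hence "M \<noteq> {}" using m(1) by auto
          thus "measure_pmf.prob Q {\<omega>. \<forall>i\<in>M. \<omega> \<in> B l i} \<le> \<pi> l ^ m"
            using joint[OF M(1) _ l1(1)] mC M(2) by simp
        qed (simp add: \<pi>_def)
        also have "exp 1 * real (card S) / q l * \<pi> l = exp 1 * (real l * (real l + 1)) * \<pi> l"
          using N l1 by (simp add: q_def N_def[symmetric])
        also have "\<dots> ^ m \<le> exp (- 1) ^ m"
          unfolding \<pi>_def using l1 L(3) pos cc R0 by (intro power_mono level_factor_le) auto
        also have "\<dots> = exp (- real m)"
          by (simp flip: exp_of_nat_mult)
        also have "\<dots> \<le> Y" using m by (simp add: Y_def)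
        finally show ?thesis .
      qed
      \<comment> \<open>If no coordinate passes the top level and every level below has at most q l
        coordinates above it, \<open>layer_sum_le\<close> keeps the total error within the
        target.\<close>
      have cover: "bad \<subseteq> (\<Union>i\<in>S. B L i) \<union> (\<Union>l\<in>{1..<L}. E l)"
      proof (rule subsetI, rule ccontr)
        fix \<omega> assume "\<omega> \<in> bad" and no: "\<omega> \<notin> (\<Union>i\<in>S. B L i) \<union> (\<Union>l\<in>{1..<L}. E l)"
        have "(\<Sum>i\<in>S. w \<omega> i) \<le> real (card S) * T"
          using no by (intro layer_sum_le[OF finS T L(1)]) (auto simp: B_def E_def q_def N_def not_less)
        moreover have "real (card S) * T = real N * (1 / real R) * (tail_sq n k x / real k)"
          by (simp add: N_def T_def tl_def)
        ultimately show False using \<open>\<omega> \<in> bad\<close> by (auto simp: bad_def w_def)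
      qed
      have "measure_pmf.prob Q bad \<le> measure_pmf.prob Q ((\<Union>i\<in>S. B L i) \<union> (\<Union>l\<in>{1..<L}. E l))"
        using cover by (intro measure_pmf.finite_measure_mono) auto
      also have "\<dots> \<le> measure_pmf.prob Q (\<Union>i\<in>S. B L i) + measure_pmf.prob Q (\<Union>l\<in>{1..<L}. E l)"
        by (intro measure_Un_le) auto
      also have "\<dots> \<le> (\<Sum>i\<in>S. measure_pmf.prob Q (B L i)) + (\<Sum>l\<in>{1..<L}. measure_pmf.prob Q (E l))"
        using finS by (intro add_mono measure_pmf.finite_measure_subadditive_finite) auto
      also have "\<dots> \<le> (\<Sum>i\<in>S. 2 * Y) + (\<Sum>l\<in>{1..<L}. Y)"
        using top level by (intro add_mono sum_mono) auto
      \<comment> \<open>The top level costs 2 N Y and the L - 1 \<le> N levels cost at most N Y;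
        with D = d + 1 the total is 3 N^(-d).\<close>
      also have "\<dots> \<le> 3 * (real N * Y)"
      proof -
        have "real (L - 1) \<le> real N"
          using L N1(3)[OF NN(2)] by (simp add: \<Lambda>_def)
        hence "real (L - 1) * Y \<le> real N * Y" by (intro mult_right_mono) (auto simp: Y_def)
        thus ?thesis by (simp add: N_def mult.commute)
      qed
      also have "real N * Y = 1 / real N powr d"
      proof -
        have "real N * Y = exp (\<Lambda> + - (D * \<Lambda>))"
          unfolding exp_add Y_def using N by (simp add: \<Lambda>_def)
        also have "\<Lambda> + - (D * \<Lambda>) = - (d * \<Lambda>)" by (simp add: D_def algebra_simps)
        finally show ?thesis using N by (simp add: exp_minus powr_def \<Lambda>_def inverse_eq_divide)
      qed
      also have "3 * (1 / real N powr d) \<le> (3 + real N0 powr d) / real N powr d"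
        by (simp add: divide_right_mono)
      finally show ?thesis .
    qed
    thus "measure_pmf.prob (fully_random R n (c * k))
         {(h, s). (\<Sum>i\<in>S. (cs_estimate R n h s x i - x i)\<^sup>2)
                   > real (card S) * (1 / real R) * (tail_sq n k x / real k)}
       \<le> (3 + real N0 powr d) / real (card S) powr d"
      by (simp only: Q_def bad_def N_def C_def)
  qed
qed

end
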